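(* Let $f\in(\mathbb{R}/\mathbb{Z})\setminus\{0\}$ and let $q$ be a positive integer. Let $\pi$ be a minimal valid function for $R_f(\mathbb{R}/\mathbb{Z})$ that is continuous and piecewise linear with breakpoints in $\frac1q\mathbb{Z}/\mathbb{Z}$ and takes only rational values at the breakpoints. There exist positive integers $r=r_\pi$ and $D=D_\pi$ and a function $m_\pi\colon(0,\infty)\to\mathbb{R}$ with $m_\pi(\epsilon)=O(\epsilon^{-1})$ as $\epsilon\to0$ such that for every $\epsilon>0$ and every positive integer $m\ge m_\pi(\epsilon)$ that is an integer multiple of $r$, there exists a function $\phi\colon\mathbb{R}/\mathbb{Z}\to\mathbb{R}$ with the following properties: (i) $\phi$ is continuous and piecewise linear with breakpoints in $\frac{1}{Dmq}\mathbb{Z}/\mathbb{Z}$ and has 2 slopes; (ii) $\phi$ is extreme for $R_f(\mathbb{R}/\mathbb{Z})$; (iii) $\|\phi-\pi\|_\infty\le\epsilon$; (iv) $\phi|_{\frac1{mq}\mathbb{Z}/\mathbb{Z}}=\pi|_{\frac1{mq}\mathbb{Z}/\mathbb{Z}}$.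
   Context: For $f\in(\mathbb{R}/\mathbb{Z})\setminus\{0\}$, $R_f(\mathbb{R}/\mathbb{Z})$ is the convex hull of all finite-support functions $y\colon\mathbb{R}/\mathbb{Z}\to\mathbb{Z}_+$ with $\sum_p y(p)\,p=f$ in $\mathbb{R}/\mathbb{Z}$. A function $\pi\colon\mathbb{R}/\mathbb{Z}\to\mathbb{R}_+$ is valid for $R_f(\mathbb{R}/\mathbb{Z})$ if $\sum_p\pi(p)y(p)\ge1$ for all such $y$. A valid function $\pi$ is minimal if there is no valid $\pi^\dagger\neq\pi$ with $\pi^\dagger\le\pi$ pointwise. Equivalently (Gomory–Johnson), $\pi$ is minimal iff $\pi\ge0$, $\pi(0)=0$, $\pi(f)=1$, $\pi(x)+\pi(y)-\pi(x+y)\ge0$ for all $x,y$ (subadditivity), and $\pi(x)+\pi(f-x)=1$ for all $x$ (symmetry). A minimal valid function $\pi$ is extreme if, whenever $\pi=\frac12(\pi^++\pi^-)$ with $\pi^\pm$ minimal valid, then $\pi=\pi^+=\pi^-$. Functions on $\mathbb{R}/\mathbb{Z}$ are identified with $\mathbb{Z}$-periodic functions on $\mathbb{R}$; "piecewise linear with breakpoints in $\frac1p\mathbb{Z}/\mathbb{Z}$" means affine on each interval $[\frac ip,\frac{i+1}p]$, $i\in\mathbb{Z}$; for $\pi$, "rational values at the breakpoints" means $\pi$ takes rational values on $\frac1q\mathbb{Z}$. "2 slopes" means the derivative, where it exists, takes exactly two distinct values. *)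

theory Defs
  imports "HOL-Analysis.Analysis" "HOL-Library.Multiset" "HOL-Library.Landau_Symbols"
begin

definition rz_rel :: "real \<Rightarrow> real \<Rightarrow> bool" where
  "rz_rel x y \<longleftrightarrow> x - y \<in> \<int>"

lemma equivp_rz_rel: "equivp rz_rel"
proof (rule equivpI)
  show "reflp rz_rel" by (simp add: reflp_def rz_rel_def)
  show "symp rz_rel" unfolding symp_def rz_rel_def
    by (metis Ints_minus minus_diff_eq)
  show "transp rz_rel" unfolding transp_def rz_rel_def
    by (metis Ints_add add_diff_eq diff_add_cancel)
qed

quotient_type rz = real / rz_rel
  morphisms rep_rz rz_of
  by (rule equivp_rz_rel)

instantiation rz :: ab_group_add
begin

lift_definition zero_rz :: rz is "0::real" .

lift_definition plus_rz :: "rz \<Rightarrow> rz \<Rightarrow> rz" is "(+)"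
  unfolding rz_rel_def by (metis Ints_add add_diff_add)

lift_definition uminus_rz :: "rz \<Rightarrow> rz" is "uminus"
  unfolding rz_rel_def by (metis Ints_minus minus_diff_minus)

lift_definition minus_rz :: "rz \<Rightarrow> rz \<Rightarrow> rz" is "(-)"
proof -
  fix a b c d :: real
  assume "rz_rel a b" "rz_rel c d"
  then have "(a - b) - (c - d) \<in> \<int>" unfolding rz_rel_def by (rule Ints_diff)
  then show "rz_rel (a - c) (b - d)" by (simp add: rz_rel_def algebra_simps)
qed

instance
  by standard (transfer; simp add: rz_rel_def algebra_simps)+

end

lemma rz_of_eq_iff: "rz_of x = rz_of y \<longleftrightarrow> x - y \<in> \<int>"
  by (simp add: rz.abs_eq_iff rz_rel_def)

lemma rz_of_add: "rz_of (x + y) = rz_of x + rz_of y"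
  by (simp add: plus_rz.abs_eq)

lemma rz_of_surj: "\<exists>x. rz_of x = p"
  by (metis Quotient3_abs_rep Quotient3_rz)

instantiation rz :: topological_space
begin

definition open_rz :: "rz set \<Rightarrow> bool" where
  "open_rz U \<longleftrightarrow> open (rz_of -` U)"

instance
proof
  show "open (UNIV :: rz set)" by (simp add: open_rz_def)
  show "open (S \<inter> T)" if "open S" "open T" for S T :: "rz set"
    using that by (simp add: open_rz_def open_Int)
  show "open (\<Union>K)" if "\<forall>S\<in>K. open S" for K :: "rz set set"
    using that by (auto simp: open_rz_def vimage_Union)
qed

end

lemma continuous_on_rz_iff:
  fixes g :: "rz \<Rightarrow> 'b::topological_space"
  shows "continuous_on UNIV g \<longleftrightarrow> continuous_on UNIV (\<lambda>x. g (rz_of x))"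
  by (simp add: continuous_on_open_vimage open_rz_def vimage_def)

text \<open>
  Multisets over \<open>\<real>/\<int>\<close> are exactly the finite-support functions \<open>y : \<real>/\<int> \<rightarrow> \<int>\<^sub>+\<close>, with
  \<open>y(p) = count y p\<close>; \<open>\<Sum>p\<in>#y. p\<close> is the sum of all \<open>y(p) p\<close>, taken in the group \<open>\<real>/\<int>\<close>.
  These are the integer points whose convex hull is \<open>R\<^sub>f(\<real>/\<int>)\<close>.
\<close>

definition gj_points :: "rz \<Rightarrow> rz multiset set" where
  "gj_points f = {y. (\<Sum>p\<in>#y. p) = f}"

definition valid_fun :: "rz \<Rightarrow> (rz \<Rightarrow> real) \<Rightarrow> bool" where
  "valid_fun f \<pi> \<longleftrightarrow> (\<forall>p. 0 \<le> \<pi> p) \<and>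
     (\<forall>y\<in>gj_points f. 1 \<le> (\<Sum>p\<in>set_mset y. \<pi> p * real (count y p)))"

definition minimal_valid :: "rz \<Rightarrow> (rz \<Rightarrow> real) \<Rightarrow> bool" where
  "minimal_valid f \<pi> \<longleftrightarrow> valid_fun f \<pi> \<and>
     \<not> (\<exists>\<pi>'. valid_fun f \<pi>' \<and> \<pi>' \<noteq> \<pi> \<and> (\<forall>p. \<pi>' p \<le> \<pi> p))"

definition extreme_valid :: "rz \<Rightarrow> (rz \<Rightarrow> real) \<Rightarrow> bool" where
  "extreme_valid f \<pi> \<longleftrightarrow> minimal_valid f \<pi> \<and>
     (\<forall>\<pi>1 \<pi>2. minimal_valid f \<pi>1 \<and> minimal_valid f \<pi>2 \<and>
        (\<forall>p. \<pi> p = (\<pi>1 p + \<pi>2 p) / 2) \<longrightarrow> \<pi> = \<pi>1 \<and> \<pi> = \<pi>2)"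

text \<open>Functions on \<open>\<real>/\<int>\<close> are identified with their \<open>\<int>\<close>-periodic lifts \<open>x \<mapsto> g (rz_of x)\<close>.\<close>

definition pwl_on_grid :: "nat \<Rightarrow> (rz \<Rightarrow> real) \<Rightarrow> bool" where
  "pwl_on_grid n g \<longleftrightarrow> (\<forall>i::int. \<exists>a b. \<forall>x\<in>{real_of_int i / real n .. real_of_int (i + 1) / real n}.
     g (rz_of x) = a * x + b)"

definition slopes :: "(rz \<Rightarrow> real) \<Rightarrow> real set" where
  "slopes g = {s. \<exists>x. ((\<lambda>t. g (rz_of t)) has_real_derivative s) (at x)}"

end

theory Submission imports Defs begin

text \<open>
  Let \<open>p\<close> and \<open>F\<close> be lifts of \<open>\<pi>\<close> and \<open>f\<close> to the reals.  Subadditivity makes \<open>p\<close> Lipschitz with constant \<open>q\<close>.  Among the \<open>q\<close>-Lipschitz functions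
  that agree with \<open>p\<close> on the grid of mesh \<open>h = 1/(m q)\<close> there is a largest one, \<open>U\<close>, and a smallest one,
  \<open>L x = 1 - U (F - x)\<close>; both have slopes \<open>q\<close> and \<open>-q\<close> only, and \<open>U\<close> is subadditive.
  Neither is symmetric, but the pointwise median of \<open>L\<close>, \<open>U\<close> and a triangular wave \<open>W\<close> of period \<open>h\<close>
  around \<open>1/2\<close> with \<open>W (F - x) = 1 - W x\<close> is.  It is still subadditive: for \<open>x + y + z = F\<close> one needs
  the three values to add up to at least 1, and a value that differs from \<open>U\<close> is at least \<open>W\<close>.
  Parity of the values on the grid of mesh \<open>1/(D m q)\<close> ensures that taking minima and maxima creates no new
  breakpoints.  Extremality is the two-slope theorem of Gomory and Johnson.
\<close>


subsection \<open>Minimal valid functions\<close>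

lemma rz_of_zero: "rz_of 0 = 0"
  by (simp add: zero_rz.abs_eq)

lemma rz_of_diff: "rz_of (x - y) = rz_of x - rz_of y"
  by (simp add: minus_rz.abs_eq)

lemma rz_of_of_int: "rz_of (of_int k) = 0"
  by (simp add: rz_of_eq_iff flip: rz_of_zero)

lemma rz_of_add_of_int: "rz_of (x + of_int k) = rz_of x"
  by (simp add: rz_of_add rz_of_of_int)

lemma sum_mset_eq_sum_count:
  fixes g :: "'a \<Rightarrow> real"
  assumes "finite S" "set_mset y \<subseteq> S"
  shows "(\<Sum>p\<in>#y. g p) = (\<Sum>p\<in>S. g p * real (count y p))"
  using assms(2)
proof (induction y)
  case (add x y)
  have "(\<Sum>p\<in>S. g p * real (count (add_mset x y) p)) =
      (\<Sum>p\<in>S. g p * real (count y p) + (if x = p then g p else 0))"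
    by (rule sum.cong) (auto simp: algebra_simps)
  then show ?case using add assms(1) by (simp add: sum.distrib)
qed simp

lemma valid_fun_iff:
  "valid_fun f \<pi> \<longleftrightarrow> (\<forall>p. 0 \<le> \<pi> p) \<and> (\<forall>y. \<Sum>\<^sub># y = f \<longrightarrow> 1 \<le> (\<Sum>p\<in>#y. \<pi> p))"
proof -
  have "(\<Sum>p\<in>set_mset y. \<pi> p * real (count y p)) = (\<Sum>p\<in>#y. \<pi> p)" for y
    by (simp add: sum_mset_eq_sum_count[of "set_mset y"])
  then show ?thesis
    by (auto simp: valid_fun_def gj_points_def)
qed

lemma mset_split_at: "\<exists>A. z \<notin># A \<and> y = A + replicate_mset (count y z) z"
  by (rule exI[of _ "filter_mset (\<lambda>p. p \<noteq> z) y"])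
    (auto simp: multiset_eq_iff)

lemma sum_mset_fun_upd:
  "z \<notin># A \<Longrightarrow> (\<Sum>p\<in>#A + replicate_mset n z. (g(z := c)) p) = (\<Sum>p\<in>#A. g p) + real n * c"
  for g :: "'a \<Rightarrow> real"
  by (auto intro!: arg_cong[where f = sum_mset] image_mset_cong)

lemma sum_mset_replicate_add:
  "\<Sum>\<^sub># (replicate_mset n (x + y)) = \<Sum>\<^sub># (replicate_mset n x) + \<Sum>\<^sub># (replicate_mset n y)"
  for x y :: "'a :: comm_monoid_add"
  by (induction n) (auto simp: algebra_simps)

lemma subadditive_sum_mset:
  fixes \<pi> :: "rz \<Rightarrow> real"
  assumes "\<pi> 0 = 0" "\<And>x y. \<pi> (x + y) \<le> \<pi> x + \<pi> y"
  shows "\<pi> (\<Sum>\<^sub># y) \<le> (\<Sum>p\<in>#y. \<pi> p)"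
proof (induction y)
  case empty
  then show ?case using assms(1) by simp
next
  case (add x y)
  then show ?case using assms(2)[of x "\<Sum>\<^sub># y"] by simp
qed

text \<open>Lowering a single value of a minimal function must destroy validity. The hypothesis
  \<open>ge\<close> expresses validity of \<open>\<pi>(z := c)\<close> in terms of
  \<open>\<pi>\<close>: the copies of \<open>z\<close> are separated from the rest \<open>A\<close>,
  on which the update has no effect.\<close>

lemma minimal_valid_updateD:
  assumes min: "minimal_valid f \<pi>" and c: "0 \<le> c" "c \<le> \<pi> z"
    and ge: "\<And>A n. z \<notin># A \<Longrightarrow> \<Sum>\<^sub># A + \<Sum>\<^sub># (replicate_mset n z) = f \<Longrightarrow> 1 \<le> (\<Sum>p\<in>#A. \<pi> p) + real n * c"
  shows "\<pi> z = c"
proof (rule ccontr)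
  assume ne: "\<pi> z \<noteq> c"
  have pos: "0 \<le> \<pi> p" for p using min by (auto simp: minimal_valid_def valid_fun_def)
  have "valid_fun f (\<pi>(z := c))"
    unfolding valid_fun_iff
  proof (intro conjI allI impI)
    show "0 \<le> (\<pi>(z := c)) p" for p using pos c by simp
    fix y assume y: "\<Sum>\<^sub># y = f"
    obtain A where A: "z \<notin># A" "y = A + replicate_mset (count y z) z" using mset_split_at by metis
    have "(\<Sum>p\<in>#y. (\<pi>(z := c)) p) = (\<Sum>p\<in>#A. \<pi> p) + real (count y z) * c"
      by (subst A(2)) (rule sum_mset_fun_upd[OF A(1)])
    moreover have "\<Sum>\<^sub># A + \<Sum>\<^sub># (replicate_mset (count y z) z) = f"
      using y A(2) by (metis sum_mset.union)
    ultimately show "1 \<le> (\<Sum>p\<in>#y. (\<pi>(z := c)) p)" using ge[OF A(1)] by simp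
  qed
  moreover have "\<pi>(z := c) \<noteq> \<pi>" using ne by (metis fun_upd_same)
  moreover have "\<forall>p. (\<pi>(z := c)) p \<le> \<pi> p" using c by simp
  ultimately show False using min unfolding minimal_valid_def by blast
qed

text \<open>The Gomory-Johnson characterization. Each property of a minimal function comes from a
  candidate for a lower value at one point: \<open>0\<close> at the origin,
  \<open>\<pi> x + \<pi> y\<close> at \<open>x + y\<close>, and a rescaled \<open>\<pi> x\<close> at
  \<open>x\<close>. Conversely, subadditivity gives validity, and symmetry makes every pair
  \<open>x\<close>, \<open>f - x\<close> tight, so no value can be lowered.\<close>

lemma minimal_valid_iff:
  "minimal_valid f \<pi> \<longleftrightarrow> (\<forall>x. 0 \<le> \<pi> x) \<and> \<pi> 0 = 0 \<and>
     (\<forall>x y. \<pi> (x + y) \<le> \<pi> x + \<pi> y) \<and> (\<forall>x. \<pi> x + \<pi> (f - x) = 1)" (is "_ \<longleftrightarrow> ?R")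
proof
  assume min: "minimal_valid f \<pi>"
  then have val: "1 \<le> (\<Sum>p\<in>#y. \<pi> p)" if "\<Sum>\<^sub># y = f" for y
    using that by (auto simp: minimal_valid_def valid_fun_iff)
  have pos: "0 \<le> \<pi> p" for p using min by (auto simp: minimal_valid_def valid_fun_def)
  have zero: "\<pi> 0 = 0"
  proof (rule minimal_valid_updateD[OF min])
    fix A n assume "\<Sum>\<^sub># A + \<Sum>\<^sub># (replicate_mset n 0) = f"
    moreover have "\<Sum>\<^sub># (replicate_mset n (0::rz)) = 0" by (induction n) auto
    ultimately show "1 \<le> (\<Sum>p\<in>#A. \<pi> p) + real n * 0" using val[of A] by simp
  qed (auto simp: pos)
  have sub: "\<pi> (x + y) \<le> \<pi> x + \<pi> y" for x y
  proof (rule ccontr)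
    assume less: "\<not> \<pi> (x + y) \<le> \<pi> x + \<pi> y"
    have "\<pi> (x + y) = \<pi> x + \<pi> y"
    proof (rule minimal_valid_updateD[OF min])
      \<comment> \<open>Every copy of \<open>x + y\<close> is replaced by one \<open>x\<close> and
        one \<open>y\<close>, which keeps the group sum.\<close>
      fix A n assume "\<Sum>\<^sub># A + \<Sum>\<^sub># (replicate_mset n (x + y)) = f"
      then show "1 \<le> (\<Sum>p\<in>#A. \<pi> p) + real n * (\<pi> x + \<pi> y)"
        using val[of "A + replicate_mset n x + replicate_mset n y"]
        by (simp add: sum_mset_replicate_add algebra_simps)
    qed (use less pos in auto)
    then show False using less by simp
  qed
  have ge: "1 \<le> \<pi> x + \<pi> (f - x)" for x
    using val[of "{#x, f - x#}"] by simp
  have sym_pos: "\<pi> x + \<pi> (f - x) = 1" if "0 < \<pi> x" for x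
  proof (rule ccontr)
    define d where "d = \<pi> x + \<pi> (f - x)"
    assume "\<pi> x + \<pi> (f - x) \<noteq> 1"
    then have d: "1 < d" using ge[of x] by (simp add: d_def)
    \<comment> \<open>The excess \<open>d > 1\<close> allows division of \<open>\<pi> x\<close> by
      \<open>d\<close>. If \<open>x\<close> occurs, removing one copy leaves a multiset with sum
      \<open>f - x\<close>, of cost at least \<open>\<pi> (f - x)\<close>; so the whole multiset
      costs at least \<open>d\<close>, and dividing by \<open>d\<close> leaves at least 1.\<close>
    have "\<pi> x = \<pi> x / d"
    proof (rule minimal_valid_updateD[OF min])
      show "0 \<le> \<pi> x / d" using that d by simp
      show "\<pi> x / d \<le> \<pi> x" using that d by (simp add: field_simps)
      fix A n assume f: "\<Sum>\<^sub># A + \<Sum>\<^sub># (replicate_mset n x) = f"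
      have A0: "0 \<le> (\<Sum>p\<in>#A. \<pi> p)" using pos by (induction A) auto
      show "1 \<le> (\<Sum>p\<in>#A. \<pi> p) + real n * (\<pi> x / d)"
      proof (cases n)
        case 0
        then show ?thesis using f val[of A] by simp
      next
        case (Suc k)
        have "\<Sum>\<^sub># (A + replicate_mset k x) = f - x"
          using f Suc by (simp add: algebra_simps)
        then have "\<pi> (f - x) \<le> (\<Sum>p\<in>#A. \<pi> p) + real k * \<pi> x"
          using subadditive_sum_mset[of \<pi> "A + replicate_mset k x"] zero sub by simp
        then have "d \<le> (\<Sum>p\<in>#A. \<pi> p) + real n * \<pi> x"
          using Suc by (simp add: d_def algebra_simps)
        moreover have "(\<Sum>p\<in>#A. \<pi> p) \<le> (\<Sum>p\<in>#A. \<pi> p) * d"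
          using A0 d mult_left_mono[of 1 d] by fastforce
        ultimately have "d \<le> (\<Sum>p\<in>#A. \<pi> p) * d + real n * \<pi> x" by linarith
        then show ?thesis using d by (simp add: field_simps)
      qed
    qed
    then show False using that d by (simp add: field_simps)
  qed
  have "\<pi> x + \<pi> (f - x) = 1" for x
  proof (cases "\<pi> x = 0")
    case True
    \<comment> \<open>A zero value cannot be scaled down, so the positive case is applied at
      \<open>f - x\<close> instead.\<close>
    then have "0 < \<pi> (f - x)" using ge[of x] by simp
    from sym_pos[OF this] show ?thesis by (simp add: algebra_simps)
  next
    case False
    then show ?thesis using sym_pos pos[of x] by simp
  qed
  then show ?R using pos zero sub by blast
next
  assume R: ?R
  have "valid_fun f \<pi>"
    unfolding valid_fun_iff
  proof (intro conjI allI impI)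
    fix y assume y: "\<Sum>\<^sub># y = f"
    have "\<pi> f = 1" using R by (metis add_0 diff_zero)
    then show "1 \<le> (\<Sum>p\<in>#y. \<pi> p)" using subadditive_sum_mset[of \<pi> y] R y by simp
  qed (use R in auto)
  moreover have False
    if v: "valid_fun f \<pi>'" and ne: "\<pi>' \<noteq> \<pi>" and le: "\<forall>p. \<pi>' p \<le> \<pi> p" for \<pi>'
  proof -
    obtain x where "\<pi>' x \<noteq> \<pi> x" using ne by blast
    then have "\<pi>' x < \<pi> x" using le by (simp add: order_less_le)
    moreover have "\<pi>' (f - x) \<le> \<pi> (f - x)" using le by simp
    moreover have "1 \<le> (\<Sum>p\<in>#{#x, f - x#}. \<pi>' p)"
    proof -
      have "\<Sum>\<^sub># {#x, f - x#} = f" by simp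
      then show ?thesis using v unfolding valid_fun_iff by blast
    qed
    ultimately show False using R[THEN conjunct2, THEN conjunct2, THEN conjunct2, rule_format, of x] by simp
  qed
  ultimately show "minimal_valid f \<pi>" unfolding minimal_valid_def by blast
qed

text \<open>A bound near the origin spreads to all \<open>t\<close> by cutting \<open>t\<close> into
  \<open>Suc k\<close> equal short pieces; then \<open>P x - P y \<le> P (x - y)\<close>.\<close>

lemma subadditive_lipschitz:
  fixes P :: "real \<Rightarrow> real"
  assumes sub: "\<And>x y. P (x + y) \<le> P x + P y" and \<eta>: "0 < \<eta>"
    and near: "\<And>t. \<bar>t\<bar> \<le> \<eta> \<Longrightarrow> P t \<le> s * \<bar>t\<bar>"
  shows "P x - P y \<le> s * \<bar>x - y\<bar>"
proof -
  have mult: "P (real (Suc k) * t) \<le> real (Suc k) * P t" for k t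
  proof (induction k)
    case (Suc k)
    have "P (real (Suc (Suc k)) * t) \<le> P (real (Suc k) * t) + P t"
      using sub[of "real (Suc k) * t" t] by (simp add: algebra_simps)
    then show ?case using Suc by (simp add: algebra_simps)
  qed simp
  have far: "P t \<le> s * \<bar>t\<bar>" for t
  proof -
    obtain k where "\<bar>t\<bar> / \<eta> < real (Suc k)" using reals_Archimedean2 less_trans of_nat_less_iff lessI by metis
    then have "\<bar>t / real (Suc k)\<bar> \<le> \<eta>" using \<eta> by (simp add: field_simps)
    then have "P (t / real (Suc k)) \<le> s * \<bar>t / real (Suc k)\<bar>" by (rule near)
    then have "real (Suc k) * P (t / real (Suc k)) \<le> s * \<bar>t\<bar>"
      by (simp add: field_simps del: of_nat_Suc)
    then show ?thesis using mult[of k "t / real (Suc k)"] by (simp del: of_nat_Suc)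
  qed
  show ?thesis using sub[of y "x - y"] far[of "x - y"] by simp
qed

subsection \<open>The two-slope theorem\<close>

text \<open>The cells are closed, so for \<open>n > 0\<close> the formulas of neighbouring cells
  agree at the common grid point and continuity is built in.\<close>

definition two_slope_on_grid :: "nat \<Rightarrow> real \<Rightarrow> (real \<Rightarrow> real) \<Rightarrow> bool" where
  "two_slope_on_grid n s P \<longleftrightarrow> (\<forall>i::int. \<exists>e. (e = 1 \<or> e = -1) \<and>
     (\<forall>x\<in>{real_of_int i / real n .. real_of_int (i + 1) / real n}.
        P x = P (real_of_int i / real n) + e * s * (x - real_of_int i / real n)))"

lemma two_slope_on_gridE:
  assumes "two_slope_on_grid n s P"
  obtains e where "e = 1 \<or> e = -1"
    "\<And>x. real_of_int i / real n \<le> x \<Longrightarrow> x \<le> real_of_int (i + 1) / real n \<Longrightarrow>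
        P x = P (real_of_int i / real n) + e * s * (x - real_of_int i / real n)"
  using spec[OF assms[unfolded two_slope_on_grid_def], of i] unfolding Ball_def atLeastAtMost_iff by blast

lemma grid_cell:
  fixes x h :: real
  assumes "0 < h"
  shows "of_int \<lfloor>x / h\<rfloor> * h \<le> x" "x \<le> (of_int \<lfloor>x / h\<rfloor> + 1) * h" "x < (of_int \<lfloor>x / h\<rfloor> + 1) * h"
proof -
  define k where "k = \<lfloor>x / h\<rfloor>"
  have "of_int k \<le> x / h" "x / h < of_int k + 1" unfolding k_def by linarith+
  then show "of_int k * h \<le> x" "x \<le> (of_int k + 1) * h" "x < (of_int k + 1) * h"
    using assms by (simp_all add: pos_le_divide_eq pos_divide_less_eq)
qed

text \<open>Uniqueness will be proved on grid points only; refinement makes these points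
  dense.\<close>

lemma two_slope_on_grid_refine:
  assumes P: "two_slope_on_grid n s P" and n: "0 < n" and k: "0 < k"
  shows "two_slope_on_grid (n * k) s P"
  unfolding two_slope_on_grid_def
proof
  fix i :: int
  define j where "j = i div int k"
  have j: "j * int k \<le> i" "i + 1 \<le> (j + 1) * int k"
  proof -
    have "i = j * int k + i mod int k" by (simp add: j_def)
    moreover have "0 \<le> i mod int k" "i mod int k < int k" using k by auto
    ultimately show "j * int k \<le> i" "i + 1 \<le> (j + 1) * int k" by (auto simp: algebra_simps)
  qed
  from P obtain e where e: "e = 1 \<or> e = -1" and
    eq: "\<And>x. real_of_int j / real n \<le> x \<Longrightarrow> x \<le> real_of_int (j + 1) / real n \<Longrightarrow>
        P x = P (real_of_int j / real n) + e * s * (x - real_of_int j / real n)"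
    by (rule two_slope_on_gridE[where i = "j"]) blast
  have "real_of_int (j * int k) \<le> real_of_int i" "real_of_int (i + 1) \<le> real_of_int ((j + 1) * int k)"
    using j by (simp_all only: of_int_le_iff)
  then have "real_of_int (j * int k) / real (n * k) \<le> real_of_int i / real (n * k)"
    "real_of_int (i + 1) / real (n * k) \<le> real_of_int ((j + 1) * int k) / real (n * k)"
    by (simp_all only: divide_right_mono of_nat_0_le_iff)
  then have b: "real_of_int j / real n \<le> real_of_int i / real (n * k)"
    "real_of_int (i + 1) / real (n * k) \<le> real_of_int (j + 1) / real n"
    using k by simp_all
  have c: "real_of_int i / real (n * k) \<le> real_of_int (i + 1) / real (n * k)"
    by (simp add: divide_right_mono)
  show "\<exists>e. (e = 1 \<or> e = -1) \<and>
     (\<forall>x\<in>{real_of_int i / real (n * k) .. real_of_int (i + 1) / real (n * k)}.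
        P x = P (real_of_int i / real (n * k)) + e * s * (x - real_of_int i / real (n * k)))"
  proof (intro exI conjI ballI)
    show "e = 1 \<or> e = -1" by (rule e)
    fix x assume "x \<in> {real_of_int i / real (n * k) .. real_of_int (i + 1) / real (n * k)}"
    then have x: "real_of_int i / real (n * k) \<le> x" "x \<le> real_of_int (i + 1) / real (n * k)"
      by auto
    show "P x = P (real_of_int i / real (n * k)) + e * s * (x - real_of_int i / real (n * k))"
      unfolding eq[OF order_trans[OF b(1) x(1)] order_trans[OF x(2) b(2)]] eq[OF b(1) order_trans[OF c b(2)]]
      by (simp only: algebra_simps)
  qed
qed

lemma two_slope_on_grid_pwl:
  assumes "two_slope_on_grid n s (\<lambda>x. g (rz_of x))"
  shows "pwl_on_grid n g"
  unfolding pwl_on_grid_def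
proof
  fix i :: int
  from assms obtain e where
    eq: "\<And>x. real_of_int i / real n \<le> x \<Longrightarrow> x \<le> real_of_int (i + 1) / real n \<Longrightarrow>
        g (rz_of x) = g (rz_of (real_of_int i / real n)) + e * s * (x - real_of_int i / real n)"
    by (rule two_slope_on_gridE[where i = "i"]) blast
  show "\<exists>a b. \<forall>x\<in>{real_of_int i / real n..real_of_int (i + 1) / real n}. g (rz_of x) = a * x + b"
  proof (intro exI ballI)
    fix x assume "x \<in> {real_of_int i / real n..real_of_int (i + 1) / real n}"
    then show "g (rz_of x) = (e * s) * x + (g (rz_of (real_of_int i / real n)) - e * s * (real_of_int i / real n))"
      using eq[of x] by (simp only: atLeastAtMost_iff algebra_simps)
  qed
qed

text \<open>A nonnegative function that vanishes at 0 has to rise in both directions, which fixes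
  the signs on the two cells around 0.\<close>

lemma two_slope_near_zero:
  assumes P: "two_slope_on_grid n s P" and n: "0 < n" and s: "0 < s"
    and P0: "P 0 = 0" and pos: "\<And>x. 0 \<le> P x" and t: "\<bar>t\<bar> \<le> 1 / real n"
  shows "P t = s * \<bar>t\<bar>"
proof (cases "0 \<le> t")
  case True
  from P obtain e where e: "e = 1 \<or> e = -1" and
    eq: "\<And>x. real_of_int 0 / real n \<le> x \<Longrightarrow> x \<le> real_of_int (0 + 1) / real n \<Longrightarrow>
        P x = P (real_of_int 0 / real n) + e * s * (x - real_of_int 0 / real n)"
    by (rule two_slope_on_gridE[where i = "0"]) blast
  have "P (1 / real n) = e * s / real n" using eq[of "1 / real n"] P0 by simp
  moreover have "0 < s / real n" using n s by simp
  ultimately have "e = 1" using e pos[of "1 / real n"] by auto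
  then show ?thesis using eq[of t] True t P0 by simp
next
  case False
  from P obtain e where e: "e = 1 \<or> e = -1" and
    eq: "\<And>x. real_of_int (-1) / real n \<le> x \<Longrightarrow> x \<le> real_of_int (-1 + 1) / real n \<Longrightarrow>
        P x = P (real_of_int (-1) / real n) + e * s * (x - real_of_int (-1) / real n)"
    by (rule two_slope_on_gridE[where i = "-1"]) blast
  have 1: "P (- (1 / real n)) = - e * s / real n" using eq[of 0] P0 by simp
  moreover have "0 < s / real n" using n s by simp
  ultimately have "e = -1" using e pos[of "- (1 / real n)"] by auto
  then show ?thesis using eq[of t] False t 1 by (simp add: algebra_simps)
qed

lemma slopes_two_slope:
  assumes P: "two_slope_on_grid n s (\<lambda>x. g (rz_of x))" and n: "0 < n" and s: "0 < s"
    and g0: "g 0 = 0" and pos: "\<And>x. 0 \<le> g x"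
  shows "slopes g = {s, - s}"
proof
  let ?P = "\<lambda>x. g (rz_of x)"
  show "slopes g \<subseteq> {s, - s}"
  proof
    fix d assume "d \<in> slopes g"
    then obtain x where d: "(?P has_real_derivative d) (at x)" by (auto simp: slopes_def)
    define i where "i = \<lfloor>x / (1 / real n)\<rfloor>"
    have i: "real_of_int i / real n \<le> x" "x < real_of_int (i + 1) / real n"
      using grid_cell[of "1 / real n" x] n by (auto simp: i_def)
    from P obtain e where e: "e = 1 \<or> e = -1" and
      eq: "\<And>x. real_of_int i / real n \<le> x \<Longrightarrow> x \<le> real_of_int (i + 1) / real n \<Longrightarrow>
        ?P x = ?P (real_of_int i / real n) + e * s * (x - real_of_int i / real n)"
      by (rule two_slope_on_gridE[where i = "i"]) blast
    \<comment> \<open>The right-hand neighbourhood lies in one cell even when \<open>x\<close> is a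
      grid point, so the derivative is compared with the slope there.\<close>
    let ?S = "{x ..< real_of_int (i + 1) / real n}"
    have "((\<lambda>x. ?P (real_of_int i / real n) + e * s * (x - real_of_int i / real n))
        has_real_derivative e * s) (at x within ?S)"
      by (auto intro!: derivative_eq_intros)
    then have "(?P has_real_derivative e * s) (at x within ?S)"
    proof (rule has_field_derivative_transform_within[of _ _ _ _ 1])
      show "?P (real_of_int i / real n) + e * s * (y - real_of_int i / real n) = ?P y" if "y \<in> ?S" for y
        using eq[of y] i that by simp
    qed (use i in auto)
    moreover have "(?P has_real_derivative d) (at x within ?S)"
      using d by (rule has_field_derivative_at_within)
    moreover have "at x within ?S \<noteq> bot"
      using i by (simp add: trivial_limit_within islimpt_Ico)
    ultimately have "d = e * s"
      using has_field_derivative_unique by blast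
    then show "d \<in> {s, - s}" using e by auto
  qed
  have P0: "?P 0 = 0" using g0 by (simp add: rz_of_zero)
  have near: "?P t = s * \<bar>t\<bar>" if "\<bar>t\<bar> \<le> 1 / real n" for t
    by (rule two_slope_near_zero[OF P n s]) (use P0 pos that in auto)
  have "(?P has_real_derivative s) (at (1 / (2 * real n)))"
  proof (rule has_field_derivative_transform_within_open[of "\<lambda>t. s * t"])
    show "open {0<..<1 / real n}" by simp
    show "s * t = ?P t" if "t \<in> {0<..<1 / real n}" for t using near[of t] that by simp
  qed (use n in \<open>auto intro!: derivative_eq_intros simp: field_simps\<close>)
  moreover have "(?P has_real_derivative - s) (at (- (1 / (2 * real n))))"
  proof (rule has_field_derivative_transform_within_open[of "\<lambda>t. - s * t"])
    show "open {- (1 / real n)<..<0}" by simp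
    show "- s * t = ?P t" if "t \<in> {- (1 / real n)<..<0}" for t using near[of t] that by simp
  qed (use n in \<open>auto intro!: derivative_eq_intros simp: field_simps\<close>)
  ultimately show "{s, - s} \<subseteq> slopes g" unfolding slopes_def by blast
qed

text \<open>On the grid, a minimal function that is additive wherever the two-slope function \<open>P\<close> is
  has only two free parameters, its values \<open>a\<close>, \<open>b\<close> at \<open>1/n\<close> and \<open>-1/n\<close>.
  Periodicity gives \<open>a = b\<close>, and the value at \<open>j/n\<close> fixes \<open>a\<close>.\<close>

lemma two_slope_grid_unique:
  fixes P Q :: "real \<Rightarrow> real" and j :: nat
  assumes P: "two_slope_on_grid n s P" and n: "0 < n" and s: "0 < s"
    and P0: "P 0 = 0" and pos: "\<And>x. 0 \<le> P x" and P1: "P 1 = 0" and PF: "P (real j / real n) = 1"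
    and Q0: "Q 0 = 0" and Q1: "Q 1 = 0" and QF: "Q (real j / real n) = 1"
    and add: "\<And>x y. P x + P y = P (x + y) \<Longrightarrow> Q x + Q y = Q (x + y)"
  shows "Q (real i / real n) = P (real i / real n)"
proof -
  define a b where "a = Q (1 / real n)" and "b = Q (- (1 / real n))"
  have near: "P t = s * \<bar>t\<bar>" if "\<bar>t\<bar> \<le> 1 / real n" for t
    by (rule two_slope_near_zero[OF P n s]) (use P0 pos that in auto)
  \<comment> \<open>With \<open>u\<close> steps up and \<open>d\<close> steps down,
    \<open>u + d = i\<close> and \<open>u - d = P (i / n) * n / s\<close>, while \<open>Q\<close>
    changes by \<open>a\<close> on each step up and by \<open>-b\<close> on each step down. Solving
    for \<open>u\<close> and \<open>d\<close> in \<open>u * a - d * b\<close> gives the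
    formula.\<close>
  have Qi: "Q (real i / real n) = real i * (a - b) / 2 + P (real i / real n) * real n / s * (a + b) / 2" for i
  proof (induction i)
    case 0
    then show ?case by (simp add: P0 Q0)
  next
    case (Suc i)
    from P obtain e where e: "e = 1 \<or> e = -1" and
      eq: "\<And>x. real_of_int (int i) / real n \<le> x \<Longrightarrow> x \<le> real_of_int (int i + 1) / real n \<Longrightarrow>
        P x = P (real_of_int (int i) / real n) + e * s * (x - real_of_int (int i) / real n)"
      by (rule two_slope_on_gridE[where i = "int i"]) blast
    have split: "real (Suc i) / real n = real i / real n + 1 / real n" using n by (simp add: field_simps)
    have step: "P (real (Suc i) / real n) = P (real i / real n) + e * s / real n"
      using eq[of "real (Suc i) / real n"] n by (simp add: field_simps)
    from e show ?case
    proof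
      assume "e = 1"
      then have st: "P (real (Suc i) / real n) = P (real i / real n) + s / real n" using step by simp
      then have "P (real i / real n) + P (1 / real n) = P (real i / real n + 1 / real n)"
        unfolding split[symmetric] using near[of "1 / real n"] by simp
      from add[OF this] have "Q (real (Suc i) / real n) = Q (real i / real n) + a"
        unfolding split[symmetric] a_def by simp
      moreover have "(P (real i / real n) + s / real n) * real n / s * (a + b) / 2
          = P (real i / real n) * real n / s * (a + b) / 2 + (a + b) / 2"
        using n s by (simp add: add_divide_distrib diff_divide_distrib algebra_simps)
      ultimately show ?thesis unfolding st Suc by (simp add: field_simps)
    next
      assume "e = -1"
      then have st: "P (real (Suc i) / real n) = P (real i / real n) - s / real n" using step by simp
      \<comment> \<open>A step down is additive when read backwards, from \<open>Suc i\<close> to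
        \<open>i\<close>.\<close>
      then have "P (real (Suc i) / real n) + P (- (1 / real n)) = P (real (Suc i) / real n + - (1 / real n))"
        using near[of "- (1 / real n)"] unfolding split by simp
      from add[OF this] have "Q (real (Suc i) / real n) = Q (real i / real n) - b"
        unfolding split b_def by simp
      moreover have "(P (real i / real n) - s / real n) * real n / s * (a + b) / 2
          = P (real i / real n) * real n / s * (a + b) / 2 - (a + b) / 2"
        using n s by (simp add: add_divide_distrib diff_divide_distrib algebra_simps)
      ultimately show ?thesis unfolding st Suc by (simp add: field_simps)
    qed
  qed
  have "a = b" using Qi[of n] n P1 Q1 by simp
  then have Qi': "Q (real i / real n) = P (real i / real n) * (real n / s * a)" for i
    using Qi[of i] by (simp add: field_simps)
  have "real n / s * a = 1" using Qi'[of j] unfolding PF QF by (simp only: mult_1)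
  then show ?thesis unfolding Qi'[of i] by (simp only: mult_1_right)
qed

text \<open>Where \<open>\<phi>\<close> is additive, both functions averaging to it are additive
  too. So each agrees with \<open>\<phi>\<close> on every refined grid, and Lipschitz bounds extend
  the equality to all points.\<close>

theorem two_slope_extreme:
  assumes min: "minimal_valid f \<phi>" and P: "two_slope_on_grid n s (\<lambda>x. \<phi> (rz_of x))"
    and n: "0 < n" and s: "0 < s" and f: "f = rz_of (real j / real n)"
  shows "extreme_valid f \<phi>"
proof -
  let ?P = "\<lambda>x. \<phi> (rz_of x)"
  have M: "\<And>x. 0 \<le> g x" "g 0 = 0" "\<And>x y. g (x + y) \<le> g x + g y" "g f = 1"
    if "minimal_valid f g" for g
  proof -
    note R = iffD1[OF minimal_valid_iff that]
    show "\<And>x. 0 \<le> g x" "g 0 = 0" "\<And>x y. g (x + y) \<le> g x + g y" using R by auto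
    have "g 0 + g (f - 0) = 1" using R by blast
    then show "g f = 1" using R by simp
  qed
  have rz1: "rz_of 1 = 0" using rz_of_of_int[of 1] by simp
  have near: "?P t = s * \<bar>t\<bar>" if "\<bar>t\<bar> \<le> 1 / real n" for t
    by (rule two_slope_near_zero[OF P n s]) (use M[OF min] that in \<open>auto simp: rz_of_zero\<close>)
  have main: "g = \<phi>"
    if g: "minimal_valid f g" and g': "minimal_valid f g'" and avg: "\<And>p. \<phi> p = (g p + g' p) / 2"
    for g g'
  proof
    fix p
    let ?Q = "\<lambda>x. g (rz_of x)"
    obtain x0 where x0: "rz_of x0 = p" using rz_of_surj by blast
    define x where "x = frac x0"
    have x: "rz_of x = p" "0 \<le> x"
      using rz_of_add_of_int[of x "\<lfloor>x0\<rfloor>"] x0 by (auto simp: x_def frac_def)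
    have add: "?Q u + ?Q v = ?Q (u + v)" if "?P u + ?P v = ?P (u + v)" for u v
      using M(3)[OF g, of "rz_of u" "rz_of v"] M(3)[OF g', of "rz_of u" "rz_of v"] that
        avg[of "rz_of u"] avg[of "rz_of v"] avg[of "rz_of u + rz_of v"]
      unfolding rz_of_add by argo
    have grid: "?Q (real i / real (n * k)) = ?P (real i / real (n * k))" if "0 < k" for i k
    proof (rule two_slope_grid_unique[OF two_slope_on_grid_refine[OF P n that], where j = "j * k"])
      have "real (j * k) / real (n * k) = real j / real n" using that by simp
      then show "\<phi> (rz_of (real (j * k) / real (n * k))) = 1" "g (rz_of (real (j * k) / real (n * k))) = 1"
        using M[OF min] M[OF g] f by simp_all
      show "?Q u + ?Q v = ?Q (u + v)" if "?P u + ?P v = ?P (u + v)" for u v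
        using that by (rule add)
    qed (use n s that M(1,2)[OF min] M(2)[OF g] in \<open>simp_all add: rz1 rz_of_zero\<close>)
    have lipP: "?P u - ?P v \<le> s * \<bar>u - v\<bar>" for u v
      by (rule subadditive_lipschitz[of _ "1 / real n"]) (use n M(3)[OF min] near in \<open>auto simp: rz_of_add\<close>)
    \<comment> \<open>Since \<open>g'\<close> is nonnegative, \<open>g\<close> is at most
      \<open>2 * \<phi>\<close>, whence the factor 2.\<close>
    have lipQ: "?Q u - ?Q v \<le> (2 * s) * \<bar>u - v\<bar>" for u v
    proof (rule subadditive_lipschitz[of _ "1 / real n"])
      show "?Q t \<le> 2 * s * \<bar>t\<bar>" if "\<bar>t\<bar> \<le> 1 / real n" for t
        using near[OF that] M(1)[OF g', of "rz_of t"] avg[of "rz_of t"] by simp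
    qed (use n M(3)[OF g] in \<open>auto simp: rz_of_add\<close>)
    \<comment> \<open>The constant 3 adds the Lipschitz factors 1 of \<open>\<phi>\<close> and 2 of
      \<open>g\<close> on the way to a nearby grid point.\<close>
    have close: "\<bar>?Q x - ?P x\<bar> \<le> 3 * s / real (Suc k)" for k
    proof -
      define N where "N = n * Suc k"
      define i where "i = nat \<lfloor>x * real N\<rfloor>"
      define y where "y = real i / real N"
      have N: "0 < real N" using n by (simp add: N_def del: of_nat_Suc of_nat_mult)
      have "1 * Suc k \<le> N" unfolding N_def using n by (intro mult_right_mono) auto
      then have kN: "real (Suc k) \<le> real N" by (simp only: of_nat_le_iff mult_1)
      have "real i = of_int \<lfloor>x * real N\<rfloor>" using x N by (simp add: i_def)
      then have "\<bar>x * real N - real i\<bar> \<le> 1" by linarith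
      then have "\<bar>x - y\<bar> \<le> 1 / real N"
        using N by (simp add: y_def field_simps abs_le_iff)
      also have "\<dots> \<le> 1 / real (Suc k)" using N kN by (simp add: frac_le del: of_nat_Suc)
      finally have xy: "s * \<bar>x - y\<bar> \<le> s / real (Suc k)" using s by (simp add: field_simps del: of_nat_Suc)
      have "?Q y = ?P y" using grid[of "Suc k" i] by (simp add: y_def N_def)
      then show ?thesis
        using lipP[of x y] lipP[of y x] lipQ[of x y] lipQ[of y x] xy
        by (simp add: abs_minus_commute[of y x] del: of_nat_Suc)
    qed
    have "(\<lambda>k. 3 * s / real (Suc k)) \<longlonglongrightarrow> 0"
      using LIMSEQ_Suc[OF lim_const_over_n[of "3 * s"]] by simp
    then have "\<bar>?Q x - ?P x\<bar> \<le> 0" by (rule LIMSEQ_le_const) (use close in blast)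
    then show "g p = \<phi> p" using x by simp
  qed
  show ?thesis
    unfolding extreme_valid_def
  proof (intro conjI allI impI min)
    fix g g' assume *: "minimal_valid f g \<and> minimal_valid f g' \<and> (\<forall>p. \<phi> p = (g p + g' p) / 2)"
    show "\<phi> = g" by (rule main[symmetric, of g g']) (use * in auto)
    show "\<phi> = g'" by (rule main[symmetric, of g' g]) (use * in \<open>auto simp: add.commute\<close>)
  qed
qed

subsection \<open>The largest Lipschitz extension from a grid\<close>

text \<open>For \<open>s\<close>-Lipschitz \<open>p\<close> this is the lower envelope of all cones
  \<open>p (j * h) + s * \<bar>x - j * h\<bar>\<close>, as \<open>U_le\<close> and
  \<open>U_attained\<close> show. Only the cones at the two ends of the cell have to be
  compared.\<close>

definition upper_ext :: "real \<Rightarrow> real \<Rightarrow> (real \<Rightarrow> real) \<Rightarrow> real \<Rightarrow> real" where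
  "upper_ext h s p x = (let k = of_int \<lfloor>x / h\<rfloor> in
     min (p (k * h) + s * (x - k * h)) (p ((k + 1) * h) + s * ((k + 1) * h - x)))"

locale grid_lipschitz =
  fixes h s :: real and p :: "real \<Rightarrow> real"
  assumes h: "0 < h" and s: "0 < s" and lip: "p x - p y \<le> s * \<bar>x - y\<bar>"
begin

abbreviation "U \<equiv> upper_ext h s p"

text \<open>A cone with apex outside the cell stays above the cone at the nearer end, because
  \<open>p\<close> grows by at most \<open>s\<close> times the distance between the apexes.\<close>

lemma cell_min_le:
  fixes j k :: int
  assumes x: "of_int k * h \<le> x" "x \<le> (of_int k + 1) * h"
  shows "min (p (of_int k * h) + s * (x - of_int k * h))
      (p ((of_int k + 1) * h) + s * ((of_int k + 1) * h - x)) \<le> p (of_int j * h) + s * \<bar>x - of_int j * h\<bar>"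
proof (cases "j \<le> k")
  case True
  then have j: "real_of_int j * h \<le> real_of_int k * h" using h by simp
  then have "p (of_int k * h) - p (of_int j * h) \<le> s * (of_int k * h - of_int j * h)"
    using lip[of "of_int k * h" "of_int j * h"] by simp
  moreover have "\<bar>x - of_int j * h\<bar> = (x - of_int k * h) + (of_int k * h - of_int j * h)" using j x by simp
  ultimately show ?thesis unfolding min_le_iff_disj by (simp only: distrib_left) linarith
next
  case False
  then have "real_of_int k + 1 \<le> real_of_int j" by linarith
  then have j: "(real_of_int k + 1) * h \<le> real_of_int j * h" using h by simp
  then have "p ((of_int k + 1) * h) - p (of_int j * h) \<le> s * (of_int j * h - (of_int k + 1) * h)"
    using lip[of "(of_int k + 1) * h" "of_int j * h"] by (simp add: abs_minus_commute)
  moreover have "\<bar>x - of_int j * h\<bar> = ((of_int k + 1) * h - x) + (of_int j * h - (of_int k + 1) * h)"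
    using j x by simp
  ultimately show ?thesis by (simp only: distrib_left min_le_iff_disj) linarith
qed

lemma U_le: "U x \<le> p (of_int j * h) + s * \<bar>x - of_int j * h\<bar>"
  unfolding upper_ext_def Let_def by (rule cell_min_le) (rule grid_cell[OF h])+

lemma U_attained: "\<exists>j::int. U x = p (of_int j * h) + s * \<bar>x - of_int j * h\<bar>"
proof -
  define k where "k = \<lfloor>x / h\<rfloor>"
  have k: "of_int k * h \<le> x" "x \<le> (of_int k + 1) * h" using grid_cell[OF h, of x] by (simp_all add: k_def)
  have "U x = p (of_int k * h) + s * (x - of_int k * h)
      \<or> U x = p ((of_int k + 1) * h) + s * ((of_int k + 1) * h - x)"
    unfolding upper_ext_def Let_def k_def[symmetric] by (simp add: min_def)
  then show ?thesis
  proof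
    assume "U x = p (of_int k * h) + s * (x - of_int k * h)"
    then show ?thesis using k by (intro exI[of _ k]) simp
  next
    assume "U x = p ((of_int k + 1) * h) + s * ((of_int k + 1) * h - x)"
    then show ?thesis using k by (intro exI[of _ "k + 1"]) simp
  qed
qed

text \<open>The definition assigns the right end of a cell to the next cell through the floor; here
  the formula is extended to the closed cell.\<close>

lemma U_cell:
  fixes k :: int
  assumes x: "of_int k * h \<le> x" "x \<le> (of_int k + 1) * h"
  shows "U x = min (p (of_int k * h) + s * (x - of_int k * h))
      (p ((of_int k + 1) * h) + s * ((of_int k + 1) * h - x))"
proof (rule antisym)
  show "U x \<le> min (p (of_int k * h) + s * (x - of_int k * h))
      (p ((of_int k + 1) * h) + s * ((of_int k + 1) * h - x))"
    using U_le[of x k] U_le[of x "k + 1"] x by simp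
  obtain j :: int where "U x = p (of_int j * h) + s * \<bar>x - of_int j * h\<bar>" using U_attained by blast
  then show "min (p (of_int k * h) + s * (x - of_int k * h))
      (p ((of_int k + 1) * h) + s * ((of_int k + 1) * h - x)) \<le> U x"
    using cell_min_le[OF x] by simp
qed

lemma U_ge: "p x \<le> U x"
proof -
  obtain j :: int where "U x = p (of_int j * h) + s * \<bar>x - of_int j * h\<bar>" using U_attained by blast
  then show ?thesis using lip[of x "of_int j * h"] by simp
qed

lemma U_grid: "U (of_int j * h) = p (of_int j * h)"
  using U_ge[of "of_int j * h"] U_le[of "of_int j * h" j] by simp

text \<open>Going to the left grid point and back costs at most \<open>s * h\<close> each
  way.\<close>

lemma U_le_near: "U x \<le> p x + 2 * (s * h)"
proof -
  define k where "k = \<lfloor>x / h\<rfloor>"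
  have k: "of_int k * h \<le> x" "x \<le> (of_int k + 1) * h" using grid_cell[OF h, of x] by (simp_all add: k_def)
  have "s * \<bar>x - of_int k * h\<bar> \<le> s * h" using k s by (intro mult_left_mono) (auto simp: algebra_simps)
  moreover have "p (of_int k * h) - p x \<le> s * \<bar>x - of_int k * h\<bar>"
    using lip[of "of_int k * h" x] by (simp add: abs_minus_commute)
  ultimately show ?thesis using U_le[of x k] by linarith
qed

text \<open>The apexes of the cones active at \<open>x\<close> and \<open>y\<close> add up to a grid
  point, and the cone there bounds \<open>U (x + y)\<close>.\<close>

lemma U_subadditive:
  assumes sub: "\<And>x y. p (x + y) \<le> p x + p y"
  shows "U (x + y) \<le> U x + U y"
proof -
  obtain i j :: int where i: "U x = p (of_int i * h) + s * \<bar>x - of_int i * h\<bar>"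
    and j: "U y = p (of_int j * h) + s * \<bar>y - of_int j * h\<bar>" using U_attained by meson
  have "U (x + y) \<le> p (of_int i * h + of_int j * h) + s * \<bar>(x - of_int i * h) + (y - of_int j * h)\<bar>"
    using U_le[of "x + y" "i + j"] by (simp add: algebra_simps)
  also have "\<dots> \<le> p (of_int i * h) + p (of_int j * h) + s * (\<bar>x - of_int i * h\<bar> + \<bar>y - of_int j * h\<bar>)"
    using s by (intro add_mono sub mult_left_mono abs_triangle_ineq) auto
  finally show ?thesis unfolding i j by (simp add: algebra_simps)
qed

lemma U_shift:
  assumes per: "\<And>x. p (x + of_int i * h) = p x"
  shows "U (x + of_int i * h) = U x"
proof (rule antisym)
  obtain j :: int where j: "U x = p (of_int j * h) + s * \<bar>x - of_int j * h\<bar>" using U_attained by blast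
  show "U (x + of_int i * h) \<le> U x"
    using U_le[of "x + of_int i * h" "j + i"] per[of "of_int j * h"] j by (simp add: algebra_simps)
  obtain j :: int where j: "U (x + of_int i * h) = p (of_int j * h) + s * \<bar>x + of_int i * h - of_int j * h\<bar>"
    using U_attained by blast
  show "U x \<le> U (x + of_int i * h)"
    using U_le[of x "j - i"] per[of "of_int (j - i) * h"] j by (simp add: algebra_simps)
qed

end

subsection \<open>Zigzag functions\<close>

text \<open>In the units \<open>1 / c\<close> and \<open>v\<close> such a function is a lattice path
  with diagonal steps; \<open>even (n - i)\<close> keeps it on one colour of the
  checkerboard.\<close>

definition zigzag_at :: "real \<Rightarrow> real \<Rightarrow> int \<Rightarrow> (real \<Rightarrow> real) \<Rightarrow> bool" where
  "zigzag_at c v i \<psi> \<longleftrightarrow> (\<exists>n e::int. (e = 1 \<or> e = -1) \<and> even (n - i) \<and>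
     (\<forall>x. of_int i \<le> c * x \<longrightarrow> c * x \<le> of_int i + 1 \<longrightarrow> \<psi> x = v * (of_int n + of_int e * (c * x - of_int i))))"

lemma zigzag_at_cong:
  assumes "zigzag_at c v i \<psi>" "\<And>x. of_int i \<le> c * x \<Longrightarrow> c * x \<le> of_int i + 1 \<Longrightarrow> \<psi>' x = \<psi> x"
  shows "zigzag_at c v i \<psi>'"
  using assms unfolding zigzag_at_def by metis

text \<open>The parity condition rules out crossings in the interior of a cell.\<close>

lemma zigzag_at_total:
  assumes v: "0 < v" and 1: "zigzag_at c v i \<psi>1" and 2: "zigzag_at c v i \<psi>2"
  shows "(\<forall>x. of_int i \<le> c * x \<longrightarrow> c * x \<le> of_int i + 1 \<longrightarrow> \<psi>1 x \<le> \<psi>2 x) \<or>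
    (\<forall>x. of_int i \<le> c * x \<longrightarrow> c * x \<le> of_int i + 1 \<longrightarrow> \<psi>2 x \<le> \<psi>1 x)"
proof -
  have aux: "\<forall>x. of_int i \<le> c * x \<longrightarrow> c * x \<le> of_int i + 1 \<longrightarrow> \<psi>1 x \<le> \<psi>2 x"
    if \<psi>1: "\<And>x. of_int i \<le> c * x \<Longrightarrow> c * x \<le> of_int i + 1 \<Longrightarrow> \<psi>1 x = v * (of_int n1 + of_int e1 * (c * x - of_int i))"
      and \<psi>2: "\<And>x. of_int i \<le> c * x \<Longrightarrow> c * x \<le> of_int i + 1 \<Longrightarrow> \<psi>2 x = v * (of_int n2 + of_int e2 * (c * x - of_int i))"
      and e: "e1 = 1 \<or> e1 = -1" "e2 = 1 \<or> e2 = -1" and n: "n1 + 2 \<le> n2 \<or> n1 = n2 \<and> e1 \<le> e2"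
    for n1 e1 n2 e2 :: int and \<psi>1 \<psi>2
  proof (intro allI impI)
    fix x assume x: "of_int i \<le> c * x" "c * x \<le> of_int i + 1"
    have "real_of_int n1 + 2 \<le> real_of_int n2 \<or> n1 = n2 \<and> e1 \<le> e2" using n by linarith
    then have "of_int n1 + of_int e1 * (c * x - of_int i) \<le> of_int n2 + of_int e2 * (c * x - of_int i)"
      using e x by auto
    then show "\<psi>1 x \<le> \<psi>2 x" unfolding \<psi>1[OF x] \<psi>2[OF x] using v by (intro mult_left_mono) auto
  qed
  obtain n1 e1 n2 e2 :: int where n: "even (n1 - i)" "even (n2 - i)" and e: "e1 = 1 \<or> e1 = -1" "e2 = 1 \<or> e2 = -1"
    and \<psi>: "\<And>x. of_int i \<le> c * x \<Longrightarrow> c * x \<le> of_int i + 1 \<Longrightarrow> \<psi>1 x = v * (of_int n1 + of_int e1 * (c * x - of_int i))"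
      "\<And>x. of_int i \<le> c * x \<Longrightarrow> c * x \<le> of_int i + 1 \<Longrightarrow> \<psi>2 x = v * (of_int n2 + of_int e2 * (c * x - of_int i))"
    using 1 2 unfolding zigzag_at_def by blast
  \<comment> \<open>Left values of equal parity coincide or differ by at least 2, a gap that slopes
    of absolute value 1 can close only at the end of the cell.\<close>
  have "(n1 + 2 \<le> n2 \<or> n1 = n2 \<and> e1 \<le> e2) \<or> (n2 + 2 \<le> n1 \<or> n2 = n1 \<and> e2 \<le> e1)"
    using n by presburger
  then show ?thesis using aux[OF \<psi> e] aux[OF \<psi>(2,1) e(2,1)] by blast
qed

lemma zigzag_at_min:
  assumes "0 < v" "zigzag_at c v i \<psi>1" "zigzag_at c v i \<psi>2"
  shows "zigzag_at c v i (\<lambda>x. min (\<psi>1 x) (\<psi>2 x))"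
  using zigzag_at_total[OF assms]
proof
  assume "\<forall>x. of_int i \<le> c * x \<longrightarrow> c * x \<le> of_int i + 1 \<longrightarrow> \<psi>1 x \<le> \<psi>2 x"
  then show ?thesis by (intro zigzag_at_cong[OF assms(2)]) auto
next
  assume "\<forall>x. of_int i \<le> c * x \<longrightarrow> c * x \<le> of_int i + 1 \<longrightarrow> \<psi>2 x \<le> \<psi>1 x"
  then show ?thesis by (intro zigzag_at_cong[OF assms(3)]) auto
qed

lemma zigzag_at_max:
  assumes "0 < v" "zigzag_at c v i \<psi>1" "zigzag_at c v i \<psi>2"
  shows "zigzag_at c v i (\<lambda>x. max (\<psi>1 x) (\<psi>2 x))"
  using zigzag_at_total[OF assms]
proof
  assume "\<forall>x. of_int i \<le> c * x \<longrightarrow> c * x \<le> of_int i + 1 \<longrightarrow> \<psi>1 x \<le> \<psi>2 x"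
  then show ?thesis by (intro zigzag_at_cong[OF assms(3)]) auto
next
  assume "\<forall>x. of_int i \<le> c * x \<longrightarrow> c * x \<le> of_int i + 1 \<longrightarrow> \<psi>2 x \<le> \<psi>1 x"
  then show ?thesis by (intro zigzag_at_cong[OF assms(2)]) auto
qed

text \<open>The apex has even coordinates, so it lies on a cell boundary and both arms have the
  right parity.\<close>

lemma zigzag_at_cone:
  "zigzag_at c v i (\<lambda>x. v * (2 * of_int K + \<bar>c * x - 2 * of_int J\<bar>))"
proof (cases "2 * J \<le> i")
  case True
  then have "2 * real_of_int J \<le> real_of_int i" by linarith
  then show ?thesis unfolding zigzag_at_def
    by (intro exI[of _ "2 * K + i - 2 * J"] exI[of _ 1]) auto
next
  case False
  then have "real_of_int i + 1 \<le> 2 * real_of_int J" by linarith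
  then show ?thesis unfolding zigzag_at_def
    by (intro exI[of _ "2 * K - i + 2 * J"] exI[of _ "-1"]) auto
qed

text \<open>The reflection maps cell \<open>i\<close> to cell \<open>2 * J - i - 1\<close> with its
  ends exchanged, so the new left value comes from the old right value \<open>n + e\<close>. The two
  sign changes of the slope cancel.\<close>

lemma zigzag_at_reflect:
  assumes "zigzag_at c v (2 * J - i - 1) \<psi>" and c: "0 < c"
  shows "zigzag_at c v i (\<lambda>x. 2 * of_int K * v - \<psi> (2 * of_int J / c - x))"
proof -
  obtain n e :: int where n: "even (n - (2 * J - i - 1))" and e: "e = 1 \<or> e = -1"
    and \<psi>: "\<And>x. of_int (2 * J - i - 1) \<le> c * x \<Longrightarrow> c * x \<le> of_int (2 * J - i - 1) + 1 \<Longrightarrow>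
      \<psi> x = v * (of_int n + of_int e * (c * x - of_int (2 * J - i - 1)))"
    using assms(1) unfolding zigzag_at_def by blast
  have cx: "c * (2 * of_int J / c - x) = 2 * of_int J - c * x" for x
    using c by (simp add: right_diff_distrib)
  show ?thesis
    unfolding zigzag_at_def
  proof (intro exI conjI allI impI)
    show "e = 1 \<or> e = -1" by (rule e)
    show "even (2 * K - n - e - i)" using n e by auto
    fix x assume x: "of_int i \<le> c * x" "c * x \<le> of_int i + 1"
    then have "\<psi> (2 * of_int J / c - x) = v * (of_int n + of_int e * (2 * of_int J - c * x - of_int (2 * J - i - 1)))"
      using \<psi>[of "2 * of_int J / c - x"] unfolding cx by simp
    then show "2 * of_int K * v - \<psi> (2 * of_int J / c - x) =
        v * (of_int (2 * K - n - e) + of_int e * (c * x - of_int i))"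
      by (simp add: algebra_simps)
  qed
qed

lemma zigzag_at_shift:
  assumes "zigzag_at c v (i + 2 * J) \<psi>" and c: "0 < c"
  shows "zigzag_at c v i (\<lambda>x. 2 * of_int K * v + \<psi> (x + 2 * of_int J / c))"
proof -
  obtain n e :: int where n: "even (n - (i + 2 * J))" and e: "e = 1 \<or> e = -1"
    and \<psi>: "\<And>x. of_int (i + 2 * J) \<le> c * x \<Longrightarrow> c * x \<le> of_int (i + 2 * J) + 1 \<Longrightarrow>
      \<psi> x = v * (of_int n + of_int e * (c * x - of_int (i + 2 * J)))"
    using assms(1) unfolding zigzag_at_def by blast
  have cx: "c * (x + 2 * of_int J / c) = c * x + 2 * of_int J" for x
    using c by (simp add: distrib_left)
  show ?thesis
    unfolding zigzag_at_def
  proof (intro exI conjI allI impI)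
    show "e = 1 \<or> e = -1" by (rule e)
    show "even (2 * K + n - i)" using n by auto
    fix x assume x: "of_int i \<le> c * x" "c * x \<le> of_int i + 1"
    then have "\<psi> (x + 2 * of_int J / c) = v * (of_int n + of_int e * (c * x + 2 * of_int J - of_int (i + 2 * J)))"
      using \<psi>[of "x + 2 * of_int J / c"] unfolding cx by simp
    then show "2 * of_int K * v + \<psi> (x + 2 * of_int J / c) =
        v * (of_int (2 * K + n) + of_int e * (c * x - of_int i))"
      by (simp add: algebra_simps)
  qed
qed

lemma two_slope_on_grid_zigzag:
  assumes z: "\<And>i. zigzag_at (real n) v i \<psi>" and n: "0 < n"
  shows "two_slope_on_grid n (real n * v) \<psi>"
  unfolding two_slope_on_grid_def
proof
  fix i
  obtain k e :: int where e: "e = 1 \<or> e = -1"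
    and \<psi>: "\<And>x. of_int i \<le> real n * x \<Longrightarrow> real n * x \<le> of_int i + 1 \<Longrightarrow>
      \<psi> x = v * (of_int k + of_int e * (real n * x - of_int i))"
    using z[of i] unfolding zigzag_at_def by blast
  show "\<exists>e. (e = 1 \<or> e = -1) \<and>
     (\<forall>x\<in>{real_of_int i / real n .. real_of_int (i + 1) / real n}.
        \<psi> x = \<psi> (real_of_int i / real n) + e * (real n * v) * (x - real_of_int i / real n))"
  proof (intro exI[of _ "of_int e"] conjI ballI)
    show "real_of_int e = 1 \<or> real_of_int e = -1" using e by auto
    fix x assume "x \<in> {real_of_int i / real n .. real_of_int (i + 1) / real n}"
    then have x: "of_int i \<le> real n * x" "real n * x \<le> of_int i + 1"
      using n by (auto simp: field_simps)
    have "\<psi> (real_of_int i / real n) = v * of_int k" using \<psi>[of "real_of_int i / real n"] n by simp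
    then show "\<psi> x = \<psi> (real_of_int i / real n) + of_int e * (real n * v) * (x - real_of_int i / real n)"
      unfolding \<psi>[OF x] using n by (simp add: field_simps)
  qed
qed

text \<open>A coarse cell consists of \<open>2 * H\<close> fine ones, and on all of it
  \<open>U\<close> is the minimum of the same two cones, whose apexes have even coordinates.\<close>

lemma (in grid_lipschitz) zigzag_at_U:
  fixes H :: int
  assumes c: "0 < c" and sc: "s = c * v" and hc: "h = 2 * of_int H / c" and v: "0 < v"
    and val: "\<And>j::int. \<exists>K::int. p (of_int j * h) = 2 * of_int K * v"
  shows "zigzag_at c v i U"
proof -
  have H: "0 < H" using h hc c by (simp add: zero_less_divide_iff)
  define k where "k = i div (2 * H)"
  have "i = k * (2 * H) + i mod (2 * H)" unfolding k_def by (rule div_mult_mod_eq[symmetric])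
  moreover have "0 \<le> i mod (2 * H)" "i mod (2 * H) < 2 * H" using H by auto
  ultimately have "k * (2 * H) \<le> i" "i + 1 \<le> (k + 1) * (2 * H)" by (auto simp: algebra_simps)
  then have "real_of_int (k * (2 * H)) \<le> real_of_int i" "real_of_int (i + 1) \<le> real_of_int ((k + 1) * (2 * H))"
    by (simp_all only: of_int_le_iff)
  then have k: "of_int k * (2 * real_of_int H) \<le> real_of_int i"
    "real_of_int i + 1 \<le> (of_int k + 1) * (2 * real_of_int H)" by simp_all
  have ch: "c * h = 2 * of_int H" using hc c by simp
  have cone: "zigzag_at c v i (\<lambda>x. p (of_int j * h) + s * \<bar>x - of_int j * h\<bar>)" for j
  proof -
    obtain K where K: "p (of_int j * h) = 2 * of_int K * v" using val by blast
    have dist: "c * \<bar>x - of_int j * h\<bar> = \<bar>c * x - 2 * of_int (j * H)\<bar>" for x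
    proof -
      have "c * \<bar>x - of_int j * h\<bar> = \<bar>c * (x - of_int j * h)\<bar>" using c by (simp add: abs_mult)
      also have "c * (x - of_int j * h) = c * x - of_int j * (c * h)" by (simp add: algebra_simps)
      finally show ?thesis unfolding ch by (simp add: algebra_simps)
    qed
    have "s * \<bar>x - of_int j * h\<bar> = v * \<bar>c * x - 2 * of_int (j * H)\<bar>" for x
      unfolding dist[symmetric] sc by (simp only: ac_simps)
    then have "(\<lambda>x. p (of_int j * h) + s * \<bar>x - of_int j * h\<bar>)
        = (\<lambda>x. v * (2 * of_int K + \<bar>c * x - 2 * of_int (j * H)\<bar>))"
      unfolding K by (simp add: distrib_left mult.commute)
    then show ?thesis using zigzag_at_cone by presburger
  qed
  show ?thesis
  proof (rule zigzag_at_cong[OF zigzag_at_min[OF v cone[of k] cone[of "k + 1"]]])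
    fix x assume x: "of_int i \<le> c * x" "c * x \<le> of_int i + 1"
    have "c * (of_int k * h) \<le> c * x" "c * x \<le> c * ((of_int k + 1) * h)"
      unfolding mult.left_commute[of c] ch using x k by linarith+
    then have kx: "of_int k * h \<le> x" "x \<le> (of_int k + 1) * h" using c by simp_all
    show "U x = min (p (of_int k * h) + s * \<bar>x - of_int k * h\<bar>)
        (p (of_int (k + 1) * h) + s * \<bar>x - of_int (k + 1) * h\<bar>)"
      using U_cell[OF kx] kx by simp
  qed
qed

subsection \<open>The symmetric two-slope extension\<close>

text \<open>That \<open>F\<close> and 1 are multiples of \<open>h\<close> makes reflection and
  periodicity respect the grid. The bound \<open>fine\<close> is equivalent to
  \<open>3 * (1 / 2 - s * h / 4) \<ge> 1\<close>: three minima of the wave still add up to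
  1.\<close>

locale symmetric_grid_lipschitz = grid_lipschitz h s p for h s :: real and p :: "real \<Rightarrow> real" +
  fixes F :: real and jF m :: int
  assumes nonneg: "0 \<le> p x" and sub: "p (x + y) \<le> p x + p y"
    and symm: "p (F - x) = 1 - p x" and per: "p (x + 1) = p x"
    and F: "F = of_int jF * h" and one: "of_int m * h = 1" and fine: "3 * (s * h) \<le> 2"
begin

abbreviation "T \<equiv> upper_ext h s (\<lambda>_. 0)"

text \<open>\<open>T\<close> is \<open>s\<close> times the distance to the grid and ranges from 0 to
  \<open>s * h / 2\<close>. Subtracting half of this amplitude centres the wave at 1/2, and the
  shift by \<open>h / 4\<close> makes it antisymmetric under reflection in \<open>F\<close>.\<close>

definition "wave x = 1 / 2 - s * h / 4 + T (x + h / 4)"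

definition "lower x = 1 - U (F - x)"

text \<open>Since \<open>lower \<le> U\<close>, this is the median of \<open>lower\<close>, \<open>U\<close> and \<open>wave\<close>.\<close>

definition "fill x = max (lower x) (min (U x) (wave x))"

sublocale T: grid_lipschitz h s "\<lambda>_. 0"
  by standard (use h s in auto)

lemma T_nonneg: "0 \<le> T x"
  using T.U_ge .

lemma T_reflect: "T (h / 2 - t) = s * h / 2 - T t"
proof -
  have cell: "T x = s * min (x - of_int k * h) ((of_int k + 1) * h - x)"
    if "of_int k * h \<le> x" "x \<le> (of_int k + 1) * h" for x k
    using T.U_cell[OF that] s by (simp add: min_mult_distrib_left)
  define k where "k = \<lfloor>t / h\<rfloor>"
  have k: "of_int k * h \<le> t" "t \<le> (of_int k + 1) * h" using grid_cell[OF h, of t] by (simp_all add: k_def)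
  define u where "u = t - of_int k * h"
  have t: "t = of_int k * h + u" and u: "0 \<le> u" "u \<le> h" using k by (simp_all add: u_def algebra_simps)
  have Tt: "T t = s * min u (h - u)" using cell[OF k] by (simp add: t algebra_simps)
  have "T (h / 2 - t) = s * (h / 2 - min u (h - u))"
  \<comment> \<open>The cases decide whether \<open>h / 2 - t\<close> lies in cell \<open>-k\<close>
    or in cell \<open>-k - 1\<close>.\<close>
  proof (cases "u \<le> h / 2")
    case True
    then have "T (h / 2 - t) = s * min (h / 2 - t - of_int (-k) * h) ((of_int (-k) + 1) * h - (h / 2 - t))"
      using u h by (intro cell) (simp_all add: t algebra_simps)
    also have "\<dots> = s * min (h / 2 - u) (h / 2 + u)" by (simp add: t algebra_simps)
    finally show ?thesis using True u by (simp add: min_def)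
  next
    case False
    then have "T (h / 2 - t) = s * min (h / 2 - t - of_int (-k-1) * h) ((of_int (-k-1) + 1) * h - (h / 2 - t))"
      using u h by (intro cell) (simp_all add: t algebra_simps)
    also have "\<dots> = s * min (3 * h / 2 - u) (u - h / 2)" by (simp add: t algebra_simps)
    finally show ?thesis using False u by (simp add: min_def)
  qed
  then show ?thesis unfolding Tt by (simp add: right_diff_distrib)
qed

lemma T_shift: "T (x + of_int i * h) = T x"
  by (rule T.U_shift) simp

lemma T_le_U: "T x \<le> U x"
proof -
  obtain j :: int where "U x = p (of_int j * h) + s * \<bar>x - of_int j * h\<bar>" using U_attained by blast
  then show ?thesis using T.U_le[of x j] nonneg[of "of_int j * h"] by simp
qed

lemma lower_le: "lower x \<le> p x"
  unfolding lower_def using U_ge[of "F - x"] symm[of x] by simp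

lemma lower_ge_near: "p x - 2 * (s * h) \<le> lower x"
  unfolding lower_def using U_le_near[of "F - x"] symm[of x] by simp

text \<open>On the grid \<open>lower\<close> and \<open>U\<close> both equal \<open>p\<close>, so
  the wave cannot affect the median.\<close>

lemma fill_grid: "fill (of_int j * h) = p (of_int j * h)"
proof -
  have "F - of_int j * h = of_int (jF - j) * h" by (simp add: F left_diff_distrib)
  then have "lower (of_int j * h) = p (of_int j * h)"
    using U_grid[of "jF - j"] symm[of "of_int j * h"] by (simp add: lower_def)
  then show ?thesis unfolding fill_def U_grid by simp
qed

lemma lower_le_fill: "lower x \<le> fill x" and fill_le_U: "fill x \<le> U x"
  using lower_le[of x] U_ge[of x] by (auto simp: fill_def)

lemma fill_near: "\<bar>fill x - p x\<bar> \<le> 2 * (s * h)"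
  using lower_le_fill[of x] fill_le_U[of x] lower_ge_near[of x] U_le_near[of x] by linarith

lemma wave_reflect: "wave (F - x) = 1 - wave x"
proof -
  have "T (F - x + h / 4) = T (h / 2 - (x + h / 4) + of_int jF * h)" by (simp add: F algebra_simps)
  also have "\<dots> = s * h / 2 - T (x + h / 4)" unfolding T_shift T_reflect ..
  finally show ?thesis by (simp add: wave_def)
qed

text \<open>Reflecting in \<open>F\<close> and subtracting from 1 exchanges \<open>lower\<close> and
  \<open>U\<close> and preserves \<open>wave\<close>; the median is compatible with this reversal of
  order.\<close>

lemma fill_symmetric: "fill x + fill (F - x) = 1"
proof -
  have "lower x \<le> U x" using lower_le[of x] U_ge[of x] by simp
  then show ?thesis unfolding fill_def wave_reflect by (simp add: lower_def min_def max_def)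
qed

lemma wave_ge: "1 / 2 - s * h / 4 \<le> wave x"
  using T_nonneg by (simp add: wave_def)

lemma fill_nonneg: "0 \<le> fill x"
proof -
  have "0 \<le> wave x" using wave_ge[of x] fine h s by simp
  moreover have "0 \<le> U x" using U_ge[of x] nonneg[of x] by simp
  ultimately show ?thesis by (simp add: fill_def)
qed

lemma fill_below: "U x \<le> fill x \<or> wave x \<le> fill x"
  by (auto simp: fill_def)

text \<open>If two of the three values are those of \<open>U\<close>, subadditivity of \<open>U\<close> suffices.  Otherwise two of them
  dominate \<open>wave\<close>, and the third one compensates the oscillation of the wave.\<close>

lemma fill_triple:
  assumes xyz: "x + y + z = F"
  shows "1 \<le> fill x + fill y + fill z"
proof -
  have two: "1 \<le> fill x + fill y + fill z" if "U x \<le> fill x" "U y \<le> fill y" "x + y + z = F" for x y z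
  proof -
    have "F - z = x + y" using that(3) by simp
    then show ?thesis
      using U_subadditive[OF sub, of x y] that(1,2) lower_le_fill[of z] by (simp add: lower_def)
  qed
  \<comment> \<open>\<open>F\<close> is a grid point, so \<open>F + h / 2\<close> is a peak of
    \<open>T\<close>.\<close>
  have half: "T (F + h / 2) = s * h / 2"
  proof -
    have "T (F + h / 2) = T (h / 2 + of_int jF * h)" by (simp add: F add.commute)
    also have "\<dots> = T (h / 2 - 0)" unfolding T_shift by simp
    also have "\<dots> = s * h / 2" unfolding T_reflect using T.U_grid[of 0] by simp
    finally show ?thesis .
  qed
  \<comment> \<open>The two waves contribute \<open>1 - s * h / 2\<close> plus two values of
    \<open>T\<close>. With \<open>T z \<le> U z\<close>, subadditivity of \<open>T\<close> and its
    peak at \<open>F + h / 2\<close> recover the missing \<open>s * h / 2\<close>.\<close>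
  have one: "1 \<le> fill x + fill y + fill z"
    if "wave x \<le> fill x" "wave y \<le> fill y" "U z \<le> fill z" "x + y + z = F" for x y z
  proof -
    have "s * h / 2 \<le> T ((x + h / 4) + ((y + h / 4) + z))"
      unfolding half[symmetric] that(4)[symmetric] by (simp add: algebra_simps)
    also have "\<dots> \<le> T (x + h / 4) + (T (y + h / 4) + T z)"
      using T.U_subadditive[of "x + h / 4" "(y + h / 4) + z"] T.U_subadditive[of "y + h / 4" z] by simp
    finally show ?thesis using that(1-3) T_le_U[of z] unfolding wave_def by linarith
  qed
  have none: "1 \<le> fill x + fill y + fill z"
    if "wave x \<le> fill x" "wave y \<le> fill y" "wave z \<le> fill z"
    using that wave_ge[of x] wave_ge[of y] wave_ge[of z] fine by linarith
  show ?thesis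
    using fill_below[of x] fill_below[of y] fill_below[of z] none xyz
      two[of x y z] two[of x z y] two[of y z x] one[of x y z] one[of x z y] one[of y z x]
    by (auto simp: algebra_simps)
qed

lemma fill_subadditive: "fill (x + y) \<le> fill x + fill y"
  using fill_triple[of x y "F - (x + y)"] fill_symmetric[of "x + y"] by simp

lemma fill_periodic: "fill (x + of_int k) = fill x"
proof -
  have km: "of_int (k * m) * h = of_int k" for k using one by simp
  have perk: "p (x + of_int k) = p x" for x k
  proof (induction k rule: int_induct[where k = 0])
    case base
    then show ?case by simp
  next
    case (step1 i)
    then show ?case using per[of "x + of_int i"] by (simp add: add.assoc)
  next
    case (step2 i)
    then show ?case using per[of "x + of_int (i - 1)"] by (simp add: algebra_simps)
  qed
  have U: "U (x + of_int k) = U x" for x k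
    by (rule U_shift[of "k * m", unfolded km, OF perk])
  have T: "T (x + of_int k) = T x" for x k
    by (rule T_shift[of _ "k * m", unfolded km])
  have "lower (x + of_int k) = lower x"
    using U[of "F - x" "-k"] by (simp add: lower_def algebra_simps)
  moreover have "wave (x + of_int k) = wave x"
    using T[of "x + h / 4" k] by (simp add: wave_def algebra_simps)
  ultimately show ?thesis by (simp add: fill_def U)
qed

text \<open>The factors 16 leave room for halving and quartering: in the units \<open>1 / c\<close>
  and \<open>v\<close>, the shift \<open>h / 4\<close> is \<open>4 * P\<close>, the offset of the
  wave is \<open>8 * C - 4 * P\<close>, and \<open>F\<close> and 1 are multiples of 16. All are
  even, so \<open>wave\<close> and \<open>lower\<close> inherit the parity.\<close>

lemma zigzag_at_fill:
  fixes P :: int and C :: int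
  assumes P: "0 < P" and c: "0 < c" and sc: "s = c * v" and hc: "h = of_int (16 * P) / c" and v: "0 < v"
    and half: "of_int (16 * C) * v = 1"
    and val: "\<And>j::int. \<exists>K::int. p (of_int j * h) = 2 * of_int K * v"
  shows "zigzag_at c v i fill"
proof -
  have U: "zigzag_at c v i U" for i
    by (rule zigzag_at_U[OF c sc _ v val, where H = "8 * P"]) (simp add: hc)
  have T: "zigzag_at c v i T" for i
    by (rule T.zigzag_at_U[OF c sc _ v, where H = "8 * P"]) (auto simp: hc intro: exI[of _ 0])
  have sh: "s * h = of_int (16 * P) * v" using sc hc c by simp
  have "zigzag_at c v i (\<lambda>x. 2 * of_int (4 * C - 2 * P) * v + T (x + 2 * of_int (2 * P) / c))"
    by (rule zigzag_at_shift[OF T c])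
  also have "2 * of_int (2 * P) / c = h / 4" by (simp add: hc)
  also have "2 * of_int (4 * C - 2 * P) * v = 1 / 2 - s * h / 4"
    using half unfolding sh by (simp add: algebra_simps)
  also have "(\<lambda>x. 1 / 2 - s * h / 4 + T (x + h / 4)) = wave"
    by (simp add: wave_def fun_eq_iff)
  finally have wave: "zigzag_at c v i wave" .
  have "zigzag_at c v i (\<lambda>x. 2 * of_int (8 * C) * v - U (2 * of_int (8 * P * jF) / c - x))"
    by (rule zigzag_at_reflect[OF U c])
  also have "2 * of_int (8 * P * jF) / c = F" unfolding F hc by simp
  also have "2 * of_int (8 * C) * v = 1" using half by simp
  also have "(\<lambda>x. 1 - U (F - x)) = lower" by (simp add: lower_def fun_eq_iff)
  finally have lower: "zigzag_at c v i lower" .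
  show ?thesis
    using zigzag_at_max[OF v lower zigzag_at_min[OF v U wave]] unfolding fill_def[abs_def] .
qed

end

subsection \<open>Approximation of piecewise linear minimal functions\<close>

text \<open>Otherwise \<open>p\<close> would be constantly 1 near \<open>F\<close>,
  hence 0 near the origin, and by subadditivity 0 everywhere.\<close>

lemma minimal_pwl_grid_point:
  fixes p :: "real \<Rightarrow> real"
  assumes q: "0 < q"
    and pwl: "\<And>i::int. \<exists>a b. \<forall>x\<in>{real_of_int i / real q .. real_of_int (i + 1) / real q}. p x = a * x + b"
    and nonneg: "\<And>x. 0 \<le> p x" and sub: "\<And>x y. p (x + y) \<le> p x + p y"
    and symm: "\<And>x. p x + p (F - x) = 1" and p0: "p 0 = 0"
  shows "\<exists>j::int. F = of_int j / real q"
proof (rule ccontr)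
  assume no: "\<nexists>j::int. F = of_int j / real q"
  define i where "i = \<lfloor>F / (1 / real q)\<rfloor>"
  define l r where "l = real_of_int i / real q" and "r = real_of_int (i + 1) / real q"
  have "l \<le> F" "F < r" using grid_cell[of "1 / real q" F] q by (simp_all add: i_def l_def r_def)
  moreover have "l \<noteq> F" using no l_def by blast
  ultimately have F: "l < F" "F < r" by simp_all
  obtain a b where ab: "\<And>x. l \<le> x \<Longrightarrow> x \<le> r \<Longrightarrow> p x = a * x + b"
    using pwl[of i] unfolding l_def r_def Ball_def atLeastAtMost_iff by blast
  have le1: "p x \<le> 1" for x using symm[of x] nonneg[of "F - x"] by simp
  have pF: "p F = 1" using symm[of 0] p0 by simp
  have "a * (r - F) \<le> 0" using ab[of r] ab[of F] F le1[of r] pF by (simp add: right_diff_distrib)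
  moreover have "a * (F - l) \<ge> 0" using ab[of l] ab[of F] F le1[of l] pF by (simp add: right_diff_distrib)
  ultimately have a: "a = 0" using F by (simp add: mult_le_0_iff zero_le_mult_iff)
  have "p t = 0" if "\<bar>t\<bar> \<le> min (F - l) (r - F)" for t
  proof -
    have "p (F - t) = p F" using ab[of "F - t"] ab[of F] F that by (simp add: a abs_le_iff)
    then show ?thesis using symm[of t] pF by simp
  qed
  then have "p F - p 0 \<le> 0 * \<bar>F - 0\<bar>"
    using F by (intro subadditive_lipschitz[OF sub, of "min (F - l) (r - F)"]) auto
  then show False using pF p0 by simp
qed

text \<open>Periodicity leaves only \<open>q\<close> values, and the product of their denominators
  works.\<close>

lemma common_denominator:
  fixes g :: "int \<Rightarrow> real"
  assumes rat: "\<And>i. g i \<in> \<rat>" and per: "\<And>i k. g (i + k * int q) = g i" and q: "0 < q"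
  shows "\<exists>P::nat. 0 < P \<and> (\<forall>i. real P * g i \<in> \<int>)"
proof -
  have "\<exists>d::nat. 0 < d \<and> real d * g i \<in> \<int>" for i
  proof -
    obtain a b :: int where "b > 0" "g i = of_int a / of_int b" using rat[of i] by (rule Rats_cases')
    then show ?thesis by (intro exI[of _ "nat b"]) auto
  qed
  then obtain d where d: "\<And>i. 0 < d i" "\<And>i. real (d i) * g i \<in> \<int>" by metis
  define P where "P = (\<Prod>i\<in>{0..<int q}. d i)"
  have "real P * g i \<in> \<int>" for i
  proof -
    define j where "j = i mod int q"
    have j: "j \<in> {0..<int q}" using q by (simp add: j_def)
    have "g i = g j" using per[of j "i div int q"] by (simp add: j_def)
    moreover have "P = (\<Prod>i\<in>{0..<int q} - {j}. d i) * d j"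
      unfolding P_def using j by (subst prod.remove[of _ j]) auto
    ultimately have "real P * g i = real (\<Prod>i\<in>{0..<int q} - {j}. d i) * (real (d j) * g j)"
      by simp
    also have "\<dots> \<in> \<int>" by (rule Ints_mult[OF Ints_of_nat d(2)])
    finally show ?thesis .
  qed
  moreover have "0 < P" unfolding P_def using d(1) by (simp add: prod_pos)
  ultimately show ?thesis by blast
qed

text \<open>On the refined grid \<open>p\<close> interpolates neighbouring coarse values with
  weights in multiples of \<open>1 / m\<close>. So only a factor \<open>m\<close> is added to the
  denominator, and \<open>D\<close> can be chosen independently of \<open>m\<close>.\<close>

lemma pwl_refined_denominator:
  fixes p :: "real \<Rightarrow> real" and j :: int
  assumes q: "0 < q" and m: "0 < m"
    and pwl: "\<And>i::int. \<exists>a b. \<forall>x\<in>{real_of_int i / real q .. real_of_int (i + 1) / real q}. p x = a * x + b"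
    and P: "\<And>i::int. real P * p (of_int i / real q) \<in> \<int>"
  shows "real (P * m) * p (of_int j / real (m * q)) \<in> \<int>"
proof -
  define i t where "i = j div int m" and "t = j mod int m"
  have j: "j = i * int m + t" and t: "0 \<le> t" "t < int m" using m by (simp_all add: i_def t_def)
  define l r where "l = real_of_int i / real q" and "r = real_of_int (i + 1) / real q"
  obtain u w where ab: "\<And>x. l \<le> x \<Longrightarrow> x \<le> r \<Longrightarrow> p x = u * x + w"
    using pwl[of i] unfolding l_def r_def Ball_def atLeastAtMost_iff by blast
  have lr: "l \<le> r" by (simp add: l_def r_def divide_right_mono)
  define a where "a = of_int t / real m"
  define z where "z = real_of_int j / real (m * q)"
  have z: "z = l + a * (r - l)"
    using q m by (simp add: z_def l_def r_def a_def j field_simps)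
  have a: "0 \<le> a" "a \<le> 1" using t m by (simp_all add: a_def field_simps)
  have "a * (r - l) \<le> r - l" "0 \<le> a * (r - l)" using a lr by (simp_all add: mult_left_le_one_le)
  then have zlr: "l \<le> z" "z \<le> r" unfolding z by linarith+
  have pz: "p z = p l + a * (p r - p l)"
    unfolding ab[OF zlr] ab[OF order_refl lr] ab[OF lr order_refl] by (simp add: z algebra_simps)
  have "real (P * m) * p z = real m * (real P * p l) + (real m * a) * (real P * p r - real P * p l)"
    unfolding pz by (simp add: algebra_simps)
  also have "real m * a = of_int t" using m by (simp add: a_def)
  also have "real m * (real P * p l) + of_int t * (real P * p r - real P * p l) \<in> \<int>"
    unfolding l_def r_def by (rule Ints_add[OF Ints_mult[OF Ints_of_nat P] Ints_mult[OF Ints_of_int Ints_diff[OF P P]]])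
  finally show ?thesis unfolding z_def .
qed

lemma continuous_on_lipschitz_real:
  fixes g :: "real \<Rightarrow> real"
  assumes lip: "\<And>x y. g x - g y \<le> s * \<bar>x - y\<bar>"
  shows "continuous_on UNIV g"
proof (rule lipschitz_on_continuous_on)
  show "\<bar>s\<bar>-lipschitz_on UNIV g"
  proof (rule lipschitz_onI)
    fix x y :: real
    have "s * \<bar>x - y\<bar> \<le> \<bar>s\<bar> * \<bar>x - y\<bar>" by (simp add: mult_right_mono)
    then show "dist (g x) (g y) \<le> \<bar>s\<bar> * dist x y"
      using lip[of x y] lip[of y x] by (simp add: dist_real_def abs_minus_commute abs_le_iff)
  qed simp
qed

lemma rep_rz_of: "\<exists>k::int. rep_rz (rz_of x) = x + of_int k"
proof -
  have "rz_of (rep_rz (rz_of x)) = rz_of x" by (rule Quotient3_abs_rep[OF Quotient3_rz])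
  then obtain k :: int where "rep_rz (rz_of x) - x = of_int k" unfolding rz_of_eq_iff by (rule Ints_cases)
  then show ?thesis by (intro exI[of _ k]) simp
qed

theorem theorem1p8:
  fixes f :: rz and q :: nat and \<pi> :: "rz \<Rightarrow> real"
  assumes "f \<noteq> 0"
    and "q > 0"
    and "minimal_valid f \<pi>"
    and "continuous_on UNIV \<pi>"
    and "pwl_on_grid q \<pi>"
    and "\<forall>i::int. \<pi> (rz_of (real_of_int i / real q)) \<in> \<rat>"
  shows "\<exists>(r::nat) (D::nat) (M :: real \<Rightarrow> real).
    r > 0 \<and> D > 0 \<and> M \<in> O[at_right 0](\<lambda>\<epsilon>. 1 / \<epsilon>) \<and>
    (\<forall>\<epsilon>>0. \<forall>m::nat. m > 0 \<and> real m \<ge> M \<epsilon> \<and> r dvd m \<longrightarrow>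
      (\<exists>\<phi> :: rz \<Rightarrow> real.
        continuous_on UNIV \<phi> \<and> pwl_on_grid (D * m * q) \<phi> \<and> card (slopes \<phi>) = 2 \<and>
        extreme_valid f \<phi> \<and>
        (\<forall>x. \<bar>\<phi> x - \<pi> x\<bar> \<le> \<epsilon>) \<and>
        (\<forall>i::int. \<phi> (rz_of (real_of_int i / real (m * q))) = \<pi> (rz_of (real_of_int i / real (m * q))))))"
proof -
  note q = assms(2)
  define p where "p x = \<pi> (rz_of x)" for x
  obtain F0 where F0: "rz_of F0 = f" using rz_of_surj by blast
  \<comment> \<open>The representative is nonnegative so that \<open>F\<close> becomes a natural
    multiple of \<open>1 / q\<close>, as \<open>two_slope_extreme\<close> requires.\<close>
  define F where "F = frac F0"
  have rz_F: "rz_of F = f" "0 \<le> F"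
    using rz_of_add_of_int[of F "\<lfloor>F0\<rfloor>"] F0 by (auto simp: F_def frac_def)
  note min = iffD1[OF minimal_valid_iff assms(3)]
  have nonneg: "0 \<le> p x" and p0: "p 0 = 0" and sub: "p (x + y) \<le> p x + p y" for x y
    using min by (simp_all add: p_def rz_of_zero rz_of_add)
  have symm: "p x + p (F - x) = 1" for x using min by (simp add: p_def rz_of_diff rz_F)
  have per: "p (x + of_int k) = p x" for x k by (simp only: p_def rz_of_add_of_int)
  have pwl: "\<exists>a b. \<forall>x\<in>{real_of_int i / real q .. real_of_int (i + 1) / real q}. p x = a * x + b" for i
    using assms(5) unfolding pwl_on_grid_def p_def by blast
  obtain j0 :: int where j0: "F = of_int j0 / real q"
    using minimal_pwl_grid_point[OF q pwl nonneg sub symm p0] by blast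
  obtain jF where jF: "F = real jF / real q"
  proof (rule that)
    have "0 \<le> j0" using rz_F(2) q by (simp add: j0 zero_le_divide_iff)
    then show "F = real (nat j0) / real q" by (simp add: j0)
  qed
  have le1: "p x \<le> 1" for x using symm[of x] nonneg[of "F - x"] by simp
  \<comment> \<open>On each side of 0, \<open>p\<close> is linear from 0 to a value at most 1 at
    distance \<open>1 / q\<close>; \<open>e\<close> below is that far end.\<close>
  have near: "p t \<le> real q * \<bar>t\<bar>" if t: "\<bar>t\<bar> \<le> 1 / real q" for t
  proof -
    have "p t \<le> real q * \<bar>t\<bar>"
      if ab: "\<And>x. l \<le> x \<Longrightarrow> x \<le> r \<Longrightarrow> p x = a * x + b" and lr: "l \<le> 0" "0 \<le> r" "l \<le> e" "e \<le> r" "l \<le> t" "t \<le> r"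
        and te: "t = \<bar>t\<bar> * real q * e" for a b l r e
    proof -
      have "b = 0" using ab[of 0] lr p0 by simp
      then have "p t = \<bar>t\<bar> * real q * p e" using ab[of t] ab[of e] lr te by (metis add_0_right mult.assoc mult.commute)
      also have "\<dots> \<le> \<bar>t\<bar> * real q * 1" by (intro mult_left_mono le1) simp
      finally show ?thesis by (simp add: mult.commute)
    qed
    note aux = this
    show ?thesis
    proof (cases "0 \<le> t")
      case True
      obtain a b where "\<And>x. 0 \<le> x \<Longrightarrow> x \<le> 1 / real q \<Longrightarrow> p x = a * x + b" using pwl[of 0] by auto
      then show ?thesis by (rule aux[where e = "1 / real q"]) (use True t q in auto)
    next
      case False
      obtain a b where "\<And>x. - (1 / real q) \<le> x \<Longrightarrow> x \<le> 0 \<Longrightarrow> p x = a * x + b" using pwl[of "-1"] by auto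
      then show ?thesis by (rule aux[where e = "- (1 / real q)"]) (use False t q in auto)
    qed
  qed
  have lip: "p x - p y \<le> real q * \<bar>x - y\<bar>" for x y
    by (rule subadditive_lipschitz[OF sub _ near, of "1 / real q"]) (use q in auto)
  obtain P :: nat where P: "0 < P" "\<And>i::int. real P * p (of_int i / real q) \<in> \<int>"
  proof -
    have "p (of_int (i + k * int q) / real q) = p (of_int i / real q)" for i k
      using per[of "of_int i / real q" k] q by (simp add: add_divide_distrib)
    then show thesis
      using common_denominator[of "\<lambda>i. p (of_int i / real q)" q] q assms(6) that
      by (auto simp: p_def)
  qed
  \<comment> \<open>In the threshold, \<open>2 / \<epsilon>\<close> makes the error
    \<open>2 * (q * h) = 2 / m\<close> at most \<open>\<epsilon>\<close>, and the summand 2 ensures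
    the mesh condition \<open>3 / m \<le> 2\<close>.\<close>
  have main: "\<exists>\<phi> :: rz \<Rightarrow> real.
        continuous_on UNIV \<phi> \<and> pwl_on_grid (16 * P * m * q) \<phi> \<and> card (slopes \<phi>) = 2 \<and>
        extreme_valid f \<phi> \<and>
        (\<forall>x. \<bar>\<phi> x - \<pi> x\<bar> \<le> \<epsilon>) \<and>
        (\<forall>i::int. \<phi> (rz_of (real_of_int i / real (m * q))) = \<pi> (rz_of (real_of_int i / real (m * q))))"
    if \<epsilon>: "0 < \<epsilon>" and m: "0 < m" and M: "2 / \<epsilon> + 2 \<le> real m" for \<epsilon> and m :: nat
  proof -
    define h where "h = 1 / real (m * q)"
    have sh: "real q * h = 1 / real m" using q by (simp add: h_def)
    have "2 \<le> real m" using M \<epsilon> by (smt (verit) divide_pos_pos)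
    interpret symmetric_grid_lipschitz h "real q" p F "int (m * jF)" "int (m * q)"
    proof
      show "3 * (real q * h) \<le> 2" unfolding sh using \<open>2 \<le> real m\<close> by (simp add: field_simps)
      show "p (x + 1) = p x" for x using per[of x 1] by simp
      show "p (F - x) = 1 - p x" for x using symm[of x] by simp
    qed (use q m nonneg sub lip in \<open>simp_all add: h_def jF\<close>)
    define n where "n = 16 * P * m * q"
    \<comment> \<open>\<open>v\<close> is the rise of slope \<open>q\<close> across one cell of
      length \<open>1 / n\<close>.\<close>
    define v where "v = 1 / real (16 * P * m)"
    have n: "0 < n" using P q m by (simp add: n_def)
    have v: "0 < v" using P m by (simp add: v_def)
    have nv: "real n * v = real q" using P m by (simp add: n_def v_def)
    have "\<exists>K::int. p (of_int j * h) = 2 * of_int K * v" for j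
    proof -
      have "real (P * m) * p (of_int j * h) \<in> \<int>"
        using pwl_refined_denominator[OF q m pwl P(2), of j] by (simp add: h_def)
      then obtain K where "real (P * m) * p (of_int j * h) = of_int K" by (rule Ints_cases)
      \<comment> \<open>A value \<open>K / (P * m)\<close> equals \<open>16 * K * v\<close>, hence
        the witness \<open>8 * K\<close>.\<close>
      then show ?thesis using P m by (intro exI[of _ "8 * K"]) (simp add: v_def field_simps)
    qed
    then have "zigzag_at (real n) v i fill" for i
      by (intro zigzag_at_fill[where P = "int P" and C = "int (P * m)"])
        (use P q m n v nv in \<open>simp_all add: n_def v_def h_def\<close>)
    then have two: "two_slope_on_grid n (real q) fill"
      using two_slope_on_grid_zigzag[of n v fill] n nv by simp
    define \<phi> where "\<phi> r = fill (rep_rz r)" for r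
    have \<phi>: "\<phi> (rz_of x) = fill x" for x
      unfolding \<phi>_def using rep_rz_of[of x] fill_periodic by metis
    have two\<phi>: "two_slope_on_grid n (real q) (\<lambda>x. \<phi> (rz_of x))" using two by (simp add: \<phi>)
    have \<phi>0: "\<phi> 0 = 0" using fill_grid[of 0] by (simp add: \<phi> p0 flip: rz_of_zero)
    have pos: "0 \<le> \<phi> r" for r unfolding \<phi>_def by (rule fill_nonneg)
    have "\<phi> (x + y) \<le> \<phi> x + \<phi> y" for x y
    proof -
      obtain a b where "x = rz_of a" "y = rz_of b" using rz_of_surj by metis
      then show ?thesis using fill_subadditive[of a b] by (simp add: \<phi> flip: rz_of_add)
    qed
    moreover have "\<phi> x + \<phi> (f - x) = 1" for x
    proof -
      obtain a where "x = rz_of a" using rz_of_surj by metis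
      moreover from this have "f - x = rz_of (F - a)" by (simp add: rz_of_diff rz_F)
      ultimately show ?thesis using fill_symmetric[of a] by (simp add: \<phi>)
    qed
    ultimately have min\<phi>: "minimal_valid f \<phi>" unfolding minimal_valid_iff using \<phi>0 pos by blast
    have lip\<phi>: "fill x - fill y \<le> real q * \<bar>x - y\<bar>" for x y
    proof (rule subadditive_lipschitz[OF fill_subadditive])
      show "fill t \<le> real q * \<bar>t\<bar>" if "\<bar>t\<bar> \<le> 1 / real n" for t
        using two_slope_near_zero[OF two n _ _ fill_nonneg that] q \<phi>0 by (simp add: \<phi> flip: rz_of_zero)
    qed (use n in auto)
    show ?thesis
    proof (intro exI[of _ \<phi>] conjI allI)
      show "continuous_on UNIV \<phi>"
        unfolding continuous_on_rz_iff \<phi> by (rule continuous_on_lipschitz_real[OF lip\<phi>])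
      show "pwl_on_grid (16 * P * m * q) \<phi>"
        using two_slope_on_grid_pwl[OF two\<phi>] by (simp add: n_def)
      show "card (slopes \<phi>) = 2"
        using slopes_two_slope[OF two\<phi> n _ \<phi>0 pos] q by simp
      show "extreme_valid f \<phi>"
      proof (rule two_slope_extreme[OF min\<phi> two\<phi> n])
        have "F = real (16 * P * m * jF) / real n" using P m by (simp add: jF n_def)
        then show "f = rz_of (real (16 * P * m * jF) / real n)" using rz_F by simp
      qed (use q in simp)
      show "\<bar>\<phi> x - \<pi> x\<bar> \<le> \<epsilon>" for x
      proof -
        obtain a where a: "x = rz_of a" using rz_of_surj by metis
        have "2 / \<epsilon> \<le> real m" using M by simp
        then have "2 * (real q * h) \<le> \<epsilon>" unfolding sh using \<epsilon> m by (simp add: field_simps)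
        then show ?thesis using fill_near[of a] by (simp add: a \<phi> p_def)
      qed
      show "\<phi> (rz_of (real_of_int i / real (m * q))) = \<pi> (rz_of (real_of_int i / real (m * q)))" for i
        using fill_grid[of i] by (simp add: \<phi> p_def h_def)
    qed
  qed
  have "(\<lambda>\<epsilon>::real. 2 / \<epsilon> + 2) \<in> O[at_right 0](\<lambda>\<epsilon>. 1 / \<epsilon>)"
  proof (rule bigoI[where c = 4])
    have "\<forall>\<^sub>F \<epsilon>::real in at_right 0. \<epsilon> \<in> {0<..<1}" by (rule eventually_at_right_real) simp
    then show "\<forall>\<^sub>F \<epsilon>::real in at_right 0. norm (2 / \<epsilon> + 2) \<le> 4 * norm (1 / \<epsilon>)"
      by eventually_elim (auto simp: field_simps)
  qed
  \<comment> \<open>\<open>r = 1\<close> works because the factor \<open>16 * P\<close> secures the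
    parity for every \<open>m\<close>.\<close>
  then show ?thesis
    using main P(1) by (intro exI[of _ 1] exI[of _ "16 * P"] exI[of _ "\<lambda>\<epsilon>. 2 / \<epsilon> + 2"]) auto
qed

end
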